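(* Let $\mathcal{P}$ be a class of finite posets of bounded width. There exists an algorithm that, given a finite poset $\mathbf{Q}$ and $\mathbf{P}\in\mathcal{P}$, decides whether $\mathbf{Q}$ embeds into $\mathbf{P}$ in time $2^{O(k\log k)}\cdot n^{O(1)}$, where $n=|P|$ and $k=|Q|$.
   Context: A poset is a finite set with a reflexive, antisymmetric, transitive relation. Width: maximum size of a set of pairwise incomparable elements; a class has bounded width if some constant bounds the width of all members. An embedding of $\mathbf{Q}$ into $\mathbf{P}$ is an injective map $e:Q\to P$ with $q\le^{\mathbf{Q}}q'$ iff $e(q)\le^{\mathbf{P}}e(q')$. *)

theory Defs
  imports Complex_Main "HOL-Library.Landau_Symbols"
begin

section \<open>Finite posets\<close>

type_synonym 'a poset = "'a set \<times> 'a rel"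

definition finite_poset :: "'a poset \<Rightarrow> bool" where
  "finite_poset P \<longleftrightarrow> finite (fst P) \<and> partial_order_on (fst P) (snd P)"

definition antichain :: "'a poset \<Rightarrow> 'a set \<Rightarrow> bool" where
  "antichain P S \<longleftrightarrow>
     S \<subseteq> fst P \<and> pairwise (\<lambda>x y. (x, y) \<notin> snd P \<and> (y, x) \<notin> snd P) S"

definition width :: "'a poset \<Rightarrow> nat" where
  "width P = Max (card ` {S. antichain P S})"

definition bounded_width :: "'a poset set \<Rightarrow> bool" where
  "bounded_width \<P> \<longleftrightarrow> (\<exists>w. \<forall>P\<in>\<P>. width P \<le> w)"

definition embedding :: "'b poset \<Rightarrow> 'a poset \<Rightarrow> ('b \<Rightarrow> 'a) \<Rightarrow> bool" where
  "embedding Q P e \<longleftrightarrow>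
     e ` fst Q \<subseteq> fst P \<and> inj_on e (fst Q) \<and>
     (\<forall>q\<in>fst Q. \<forall>q'\<in>fst Q. (q, q') \<in> snd Q \<longleftrightarrow> (e q, e q') \<in> snd P)"

definition embeds :: "'b poset \<Rightarrow> 'a poset \<Rightarrow> bool" where
  "embeds Q P \<longleftrightarrow> (\<exists>e. embedding Q P e)"


section \<open>Algorithms and their running time\<close>

text \<open>
  Algorithms are programs for a unit-cost random access machine, written in a structured
  imperative language. Values are natural numbers, and the memory consists of arrays that are
  indexed by all natural numbers; a program uses only the finitely many arrays named in it. A scalar
  variable is entry 0 of an array. Every operator, memory access, test and assignment costs
  one time unit. The only arithmetic operations are addition and (truncated)
  subtraction, so that values after \<open>t\<close> steps have \<open>O(t)\<close> bits more than the input values;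
  hence this time measure is polynomially related to that of Turing machines. Multiplication is
  deliberately not a unit-cost operation, since it would break this relation.
\<close>

type_synonym vname = string
type_synonym state = "vname \<Rightarrow> nat \<Rightarrow> nat"

datatype aexp =
    Const nat
  | Cell vname aexp
  | Plus aexp aexp
  | Minus aexp aexp

fun aval :: "aexp \<Rightarrow> state \<Rightarrow> nat" where
  "aval (Const m) s = m"
| "aval (Cell x a) s = s x (aval a s)"
| "aval (Plus a b) s = aval a s + aval b s"
| "aval (Minus a b) s = aval a s - aval b s"

fun acost :: "aexp \<Rightarrow> nat" where
  "acost (Const m) = 1"
| "acost (Cell x a) = 1 + acost a"
| "acost (Plus a b) = 1 + acost a + acost b"
| "acost (Minus a b) = 1 + acost a + acost b"

datatype bexp =
    Less aexp aexp
  | Neg bexp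
  | Conj bexp bexp

fun bval :: "bexp \<Rightarrow> state \<Rightarrow> bool" where
  "bval (Less a b) s \<longleftrightarrow> aval a s < aval b s"
| "bval (Neg b) s \<longleftrightarrow> \<not> bval b s"
| "bval (Conj b c) s \<longleftrightarrow> bval b s \<and> bval c s"

fun bcost :: "bexp \<Rightarrow> nat" where
  "bcost (Less a b) = 1 + acost a + acost b"
| "bcost (Neg b) = 1 + bcost b"
| "bcost (Conj b c) = 1 + bcost b + bcost c"

datatype com =
    Skip
  | Assign vname aexp aexp
  | Seq com com
  | Cond bexp com com
  | While bexp com

text \<open>
  \<open>exec c s t s'\<close>: started in state \<open>s\<close>, the program \<open>c\<close> terminates after exactly \<open>t\<close> time
  units, in state \<open>s'\<close>.
\<close>

inductive exec :: "com \<Rightarrow> state \<Rightarrow> nat \<Rightarrow> state \<Rightarrow> bool" where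
  Skip: "exec Skip s 1 s"
| Assign: "exec (Assign x a b) s (1 + acost a + acost b)
             (s(x := (s x)(aval a s := aval b s)))"
| Seq: "exec c s t s' \<Longrightarrow> exec d s' u s'' \<Longrightarrow> exec (Seq c d) s (t + u) s''"
| CondTrue: "bval b s \<Longrightarrow> exec c s t s' \<Longrightarrow> exec (Cond b c d) s (1 + bcost b + t) s'"
| CondFalse: "\<not> bval b s \<Longrightarrow> exec d s t s' \<Longrightarrow> exec (Cond b c d) s (1 + bcost b + t) s'"
| WhileFalse: "\<not> bval b s \<Longrightarrow> exec (While b c) s (1 + bcost b) s"
| WhileTrue: "bval b s \<Longrightarrow> exec c s t s' \<Longrightarrow> exec (While b c) s' u s'' \<Longrightarrow>
    exec (While b c) s (1 + bcost b + t + u) s''"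

inductive_cases exec_SkipE: "exec Skip s t s'"
inductive_cases exec_AssignE: "exec (Assign x a b) s t s'"
inductive_cases exec_SeqE: "exec (Seq c d) s t s'"
inductive_cases exec_CondE: "exec (Cond b c d) s t s'"
inductive_cases exec_WhileE: "exec (While b c) s t s'"

lemma exec_deterministic:
  assumes "exec c s t s'" and "exec c s u s''"
  shows "u = t \<and> s'' = s'"
  using assms
proof (induction arbitrary: u s'' rule: exec.induct)
  case (Skip s)
  show ?case by (rule exec_SkipE [OF Skip.prems]) simp
next
  case (Assign x a b s)
  show ?case by (rule exec_AssignE [OF Assign.prems]) simp
next
  case (Seq c s t1 s1 d t2 s2)
  obtain r1 z r2 where u: "u = r1 + r2" and 1: "exec c s r1 z" and 2: "exec d z r2 s''"
    by (rule exec_SeqE [OF Seq.prems])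
  have z: "r1 = t1" "z = s1"
    using Seq.IH(1) [OF 1] by simp_all
  show ?case
    using Seq.IH(2) [OF 2 [unfolded z]] by (simp add: u z)
next
  case (CondTrue b s c t1 s1 d)
  obtain r where "u = Suc (bcost b + r)" "exec c s r s''"
    by (rule exec_CondE [OF CondTrue.prems]) (simp_all add: CondTrue.hyps)
  then show ?case
    using CondTrue.IH [of r s''] by simp
next
  case (CondFalse b s d t1 s1 c)
  obtain r where "u = Suc (bcost b + r)" "exec d s r s''"
    by (rule exec_CondE [OF CondFalse.prems]) (simp_all add: CondFalse.hyps)
  then show ?case
    using CondFalse.IH [of r s''] by simp
next
  case (WhileFalse b s c)
  show ?case
    by (rule exec_WhileE [OF WhileFalse.prems]) (simp_all add: WhileFalse.hyps)
next
  case (WhileTrue b s c t1 s1 t2 s2)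
  obtain r1 z r2 where u: "u = Suc (bcost b + r1 + r2)"
    and 1: "exec c s r1 z" and 2: "exec (While b c) z r2 s''"
    by (rule exec_WhileE [OF WhileTrue.prems]) (simp_all add: WhileTrue.hyps(1))
  have z: "r1 = t1" "z = s1"
    using WhileTrue.IH(1) [OF 1] by simp_all
  show ?case
    using WhileTrue.IH(2) [OF 2 [unfolded z]] by (simp add: u z)
qed


section \<open>Input encoding\<close>

text \<open>
  A poset is presented to a program by its number of elements and the row-major 0/1 matrix of
  its order relation, with respect to an arbitrary enumeration of its elements.
\<close>

definition enumerates :: "'a list \<Rightarrow> 'a poset \<Rightarrow> bool" where
  "enumerates xs P \<longleftrightarrow> distinct xs \<and> set xs = fst P"

definition order_matrix :: "'a poset \<Rightarrow> 'a list \<Rightarrow> nat \<Rightarrow> nat" where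
  "order_matrix P xs m =
     (let n = length xs in
      if m < n * n \<and> (xs ! (m div n), xs ! (m mod n)) \<in> snd P then 1 else 0)"

definition initial_state :: "'b poset \<Rightarrow> 'b list \<Rightarrow> 'a poset \<Rightarrow> 'a list \<Rightarrow> state" where
  "initial_state Q ys P xs =
     (\<lambda>_ _. 0)
       (''k'' := (\<lambda>_. 0)(0 := length ys),
        ''Q'' := order_matrix Q ys,
        ''n'' := (\<lambda>_. 0)(0 := length xs),
        ''P'' := order_matrix P xs)"

definition accepting :: "state \<Rightarrow> bool" where
  "accepting s \<longleftrightarrow> s ''out'' 0 = 1"

end

theory Submission
  imports Defs "HOL-Library.FuncSet" "HOL-Real_Asymp.Real_Asymp"
begin

text \<open>
  Since the orders are reflexive and antisymmetric, injectivity of an embedding is automatic, so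
  we look for maps \<open>e\<close> with \<open>q \<le> q'\<close> iff \<open>e q \<le> e q'\<close>. The poset \<open>P\<close> is first partitioned into
  at most \<open>w\<close> chains, where \<open>w\<close> bounds the width; then every assignment of chains to the elements
  of \<open>Q\<close> is tried. For a fixed assignment the solutions are closed under pointwise minimum, so the
  least one is found greedily. Put every element of \<open>Q\<close> at the bottom of its chain. If \<open>q \<le> q'\<close>
  but the positions are not so ordered, then every solution above the current positions moves
  \<open>q'\<close> up; if \<open>q \<le> q'\<close> fails but the positions are so ordered, then every such solution moves
  \<open>q\<close> up. Advance the forced element by one until no pair is violated, or until an element has to
  leave its chain.

  The chain partition is a maximum matching of the strict order, viewed as a bipartite graph on
  two copies of \<open>P\<close>. An auction computes it: bidders only raise their offers and items their
  prices, so there is no search for augmenting paths.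
\<close>

section \<open>Running time bounds for programs\<close>

definition runs :: "com \<Rightarrow> state \<Rightarrow> nat \<Rightarrow> (state \<Rightarrow> bool) \<Rightarrow> bool" where
  "runs c s T R \<longleftrightarrow> (\<exists>t s'. exec c s t s' \<and> t \<le> T \<and> R s')"

fun writes :: "com \<Rightarrow> vname set" where
  "writes Skip = {}"
| "writes (Assign x a b) = {x}"
| "writes (Seq c d) = writes c \<union> writes d"
| "writes (Cond b c d) = writes c \<union> writes d"
| "writes (While b c) = writes c"

lemma exec_frame: "exec c s t s' \<Longrightarrow> x \<notin> writes c \<Longrightarrow> s' x = s x"
  by (induction rule: exec.induct) auto

lemma runs_frame:
  assumes "runs c s T R"
    and "\<And>s'. R s' \<Longrightarrow> (\<And>x. x \<notin> writes c \<Longrightarrow> s' x = s x) \<Longrightarrow> R' s'"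
  shows "runs c s T R'"
  using assms exec_frame unfolding runs_def by metis

lemma runs_weaken:
  assumes "runs c s T R" and "T \<le> T'" and "\<And>s'. R s' \<Longrightarrow> R' s'"
  shows "runs c s T' R'"
  using assms unfolding runs_def by (meson order_trans)

lemma runs_Seq:
  assumes "runs c s T R" and "\<And>s'. R s' \<Longrightarrow> runs d s' U R'"
  shows "runs (Seq c d) s (T + U) R'"
proof -
  obtain t s' where 1: "exec c s t s'" "t \<le> T" "R s'"
    using assms(1) unfolding runs_def by blast
  obtain u s'' where 2: "exec d s' u s''" "u \<le> U" "R' s''"
    using assms(2) [OF 1(3)] unfolding runs_def by blast
  show ?thesis
    unfolding runs_def
    by (intro exI [of _ "t + u"] exI [of _ s'']) (use 1 2 in \<open>auto intro: exec.Seq\<close>)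
qed

lemma runs_Cond:
  assumes "bval b s \<Longrightarrow> runs c s T R" and "\<not> bval b s \<Longrightarrow> runs d s T R"
  shows "runs (Cond b c d) s (1 + bcost b + T) R"
proof (cases "bval b s")
  case True
  then obtain t s' where "exec c s t s'" "t \<le> T" "R s'"
    using assms(1) unfolding runs_def by blast
  with True show ?thesis
    unfolding runs_def
    by (intro exI [of _ "1 + bcost b + t"] exI [of _ s']) (simp add: exec.CondTrue [simplified])
next
  case False
  then obtain t s' where "exec d s t s'" "t \<le> T" "R s'"
    using assms(2) unfolding runs_def by blast
  with False show ?thesis
    unfolding runs_def
    by (intro exI [of _ "1 + bcost b + t"] exI [of _ s']) (simp add: exec.CondFalse [simplified])
qed

text \<open>\<open>m\<close> bounds the number of iterations, each charged the same
  \<open>T\<close>; the extra 1 pays for the final failing test.\<close>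

lemma runs_While:
  assumes "I s"
    and step: "\<And>s. I s \<Longrightarrow> bval b s \<Longrightarrow> runs c s T (\<lambda>s'. I s' \<and> m s' < m s)"
  shows "runs (While b c) s ((m s + 1) * (1 + bcost b + T)) (\<lambda>s'. I s' \<and> \<not> bval b s')"
  using \<open>I s\<close>
proof (induction "m s" arbitrary: s rule: less_induct)
  case less
  show ?case
  proof (cases "bval b s")
    case False
    then show ?thesis
      unfolding runs_def
      by (intro exI [of _ "1 + bcost b"] exI [of _ s]) (simp add: exec.WhileFalse [simplified] less.prems)
  next
    case True
    obtain t s' where 1: "exec c s t s'" "t \<le> T" "I s'" "m s' < m s"
      using step [OF less.prems True] unfolding runs_def by blast
    obtain u s'' where 2: "exec (While b c) s' u s''" "u \<le> (m s' + 1) * (1 + bcost b + T)"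
      "I s''" "\<not> bval b s''"
      using less.hyps [OF 1(4) 1(3)] unfolding runs_def by blast
    have "u \<le> m s * (1 + bcost b + T)"
      using 2(2) mult_le_mono1 [of "m s' + 1" "m s" "1 + bcost b + T"] 1(4) by linarith
    then have "1 + bcost b + t + u \<le> (m s + 1) * (1 + bcost b + T)"
      using 1(2) by simp
    then show ?thesis
      unfolding runs_def
      using exec.WhileTrue [OF True 1(1) 2(1)] 2(3,4) by blast
  qed
qed

section \<open>Loop-free programs as state transformers\<close>

fun loop_free :: "com \<Rightarrow> bool" where
  "loop_free (Seq c d) \<longleftrightarrow> loop_free c \<and> loop_free d"
| "loop_free (Cond b c d) \<longleftrightarrow> loop_free c \<and> loop_free d"
| "loop_free (While b c) \<longleftrightarrow> False"
| "loop_free _ \<longleftrightarrow> True"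

fun effect :: "com \<Rightarrow> state \<Rightarrow> state" where
  "effect Skip s = s"
| "effect (Assign x a b) s = s(x := (s x)(aval a s := aval b s))"
| "effect (Seq c d) s = effect d (effect c s)"
| "effect (Cond b c d) s = (if bval b s then effect c s else effect d s)"
| "effect (While b c) s = s"

text \<open>A \<open>Cond\<close> is charged for both branches, so that the bound depends on the
  program alone and not on the state.\<close>

fun steps :: "com \<Rightarrow> nat" where
  "steps Skip = 1"
| "steps (Assign x a b) = 1 + acost a + acost b"
| "steps (Seq c d) = steps c + steps d"
| "steps (Cond b c d) = 1 + bcost b + (steps c + steps d)"
| "steps (While b c) = 0"

lemma runs_loop_free:
  assumes "loop_free c" and "R (effect c s)"
  shows "runs c s (steps c) R"
  using assms
proof (induction c arbitrary: s R)
  case Skip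
  then show ?case
    using exec.Skip [of s] by (auto simp: runs_def)
next
  case (Assign x a b)
  then show ?case
    unfolding runs_def steps.simps effect.simps by (meson exec.Assign order_refl)
next
  case (Seq c d)
  then show ?case
    by (auto intro!: runs_Seq [where R = "\<lambda>s'. s' = effect c s"])
next
  case (Cond b c d)
  have "runs (Cond b c d) s (1 + bcost b + (steps c + steps d)) R"
  proof (rule runs_Cond)
    assume "bval b s"
    then show "runs c s (steps c + steps d) R"
      using Cond by (intro runs_weaken [OF Cond.IH(1)]) auto
  next
    assume "\<not> bval b s"
    then show "runs d s (steps c + steps d) R"
      using Cond by (intro runs_weaken [OF Cond.IH(2)]) auto
  qed
  then show ?case by simp
qed simp

lemma effect_frame: "loop_free c \<Longrightarrow> x \<notin> writes c \<Longrightarrow> effect c s x = s x"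
  by (induction c arbitrary: s) auto

lemma runs_prefix:
  assumes "loop_free c" and "runs d (effect c s) T R"
  shows "runs (Seq c d) s (steps c + T) R"
  using assms by (auto intro!: runs_Seq runs_loop_free [where R = "\<lambda>s'. s' = effect c s"])

text \<open>The form used for all loops except the outermost one over chain assignments:
  preservation of \<open>I\<close> becomes a statement about \<open>effect\<close> that
  simplification can evaluate. The last premise hands the frame of the body to
  \<open>R\<close>.\<close>

lemma runs_While_loop_free:
  assumes "I s" and "loop_free c"
    and "\<And>s. I s \<Longrightarrow> bval b s \<Longrightarrow> I (effect c s) \<and> m (effect c s) < m s"
    and "(m s + 1) * (1 + bcost b + steps c) \<le> T"
    and "\<And>s'. I s' \<Longrightarrow> \<not> bval b s' \<Longrightarrow> (\<And>x. x \<notin> writes c \<Longrightarrow> s' x = s x) \<Longrightarrow> R s'"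
  shows "runs (While b c) s T R"
proof (rule runs_weaken [OF _ assms(4)])
  show "runs (While b c) s ((m s + 1) * (1 + bcost b + steps c)) R"
    by (rule runs_frame [OF runs_While [of I]])
      (use assms in \<open>auto intro: runs_loop_free\<close>)
qed

section \<open>Chain partitions by auction\<close>

locale index_poset =
  fixes n :: nat and le :: "nat \<Rightarrow> nat \<Rightarrow> bool"
  assumes le_bounded: "le u v \<Longrightarrow> u < n \<and> v < n"
    and le_refl: "u < n \<Longrightarrow> le u u"
    and le_antisym: "le u v \<Longrightarrow> le v u \<Longrightarrow> u = v"
    and le_trans: "le u v \<Longrightarrow> le v x \<Longrightarrow> le u x"
begin

definition lt :: "nat \<Rightarrow> nat \<Rightarrow> bool" where
  "lt u v \<longleftrightarrow> le u v \<and> \<not> le v u"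

lemma lt_bounded: "lt u v \<Longrightarrow> u < n \<and> v < n"
  using le_bounded lt_def by blast

lemma lt_trans: "lt u v \<Longrightarrow> lt v x \<Longrightarrow> lt u x"
  using le_trans unfolding lt_def by blast

lemma lt_irrefl [simp]: "\<not> lt u u"
  by (simp add: lt_def)

text \<open>A rank that drops strictly along \<open>lt\<close>: it ends the descent to the bottom of
  a chain and bounds the number of upward moves in the search.\<close>

definition above :: "nat \<Rightarrow> nat" where
  "above u = card {v. lt u v}"

lemma above_le: "above u \<le> n"
  unfolding above_def
  using card_mono [of "{..<n}" "{v. lt u v}"] lt_bounded by force

lemma above_less: "lt u v \<Longrightarrow> above v < above u"
  unfolding above_def
proof (rule psubset_card_mono)
  show "finite {v. lt u v}"
    by (rule finite_subset [of _ "{..<n}"]) (use lt_bounded in auto)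
  show "{x. lt v x} \<subset> {v. lt u v}" if "lt u v"
    using that lt_trans lt_irrefl by blast
qed

text \<open>
  \<open>M\<close> maps \<open>u\<close> to \<open>Suc v\<close> if \<open>v\<close> follows \<open>u\<close> in its chain and to 0 if \<open>u\<close> is a top; \<open>U\<close> is
  the partial inverse. The bidder \<open>u\<close> offers \<open>l u\<close> for any element above it, and \<open>p v\<close> is the
  price of \<open>v\<close>.
\<close>
definition matching :: "(nat \<Rightarrow> nat) \<Rightarrow> (nat \<Rightarrow> nat) \<Rightarrow> (nat \<Rightarrow> nat) \<Rightarrow> (nat \<Rightarrow> nat) \<Rightarrow> bool" where
  "matching M U l p \<longleftrightarrow>
     (\<forall>u v. M u = Suc v \<longleftrightarrow> U v = Suc u) \<and>
     (\<forall>u v. M u = Suc v \<longrightarrow> lt u v \<and> p v = Suc (l u) \<and> l u \<le> n) \<and>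
     (\<forall>v. U v = 0 \<longrightarrow> p v = 0) \<and>
     (\<forall>u v. lt u v \<longrightarrow> l u \<le> p v) \<and>
     (\<forall>u. l u \<le> Suc n)"

lemma
  assumes "matching M U l p"
  shows matching_inverse: "M u = Suc v \<longleftrightarrow> U v = Suc u"
    and matching_edge: "M u = Suc v \<Longrightarrow> lt u v" "M u = Suc v \<Longrightarrow> p v = Suc (l u)"
      "M u = Suc v \<Longrightarrow> l u \<le> n"
    and matching_free: "U v = 0 \<Longrightarrow> p v = 0"
    and matching_offer: "lt u v \<Longrightarrow> l u \<le> p v"
  using assms unfolding matching_def by blast+

text \<open>
  Some price \<open>g\<close> between 1 and \<open>n + 1\<close> is not taken. The elements with a larger price are matched,
  and everything above one of their partners, or above an unmatched element, also has a larger
  price. Hence removing the elements with a larger price from these partners and unmatched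
  elements leaves an antichain.
\<close>
lemma matching_antichain:
  assumes m: "matching M U l p"
    and settled: "\<And>u. u < n \<Longrightarrow> M u \<noteq> 0 \<or> l u = Suc n"
  obtains A where "A \<subseteq> {..<n}" and "\<And>u v. u \<in> A \<Longrightarrow> v \<in> A \<Longrightarrow> \<not> lt u v"
    and "card {v. v < n \<and> U v = 0} \<le> card A"
proof -
  note inv = matching_inverse [OF m] and edge = matching_edge [OF m]
    and p0 = matching_free [OF m] and lp = matching_offer [OF m]
  \<comment> \<open>Pigeonhole: \<open>n\<close> elements cannot take all of \<open>n + 1\<close>
    prices.\<close>
  have "\<not> {1..Suc n} \<subseteq> p ` {..<n}"
    using card_mono [of "p ` {..<n}" "{1..Suc n}"] card_image_le [of "{..<n}" p] by fastforce
  then obtain g where g: "1 \<le> g" "g \<le> Suc n" "\<And>v. v < n \<Longrightarrow> p v \<noteq> g"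
    by fastforce
  define H where "H = {v. v < n \<and> g < p v}"
  define D where "D = {u. u < n \<and> M u = 0}"
  define E where "E = (\<lambda>v. U v - 1) ` H"
  have fin: "finite H" "finite D" "finite E"
    by (auto simp: H_def D_def E_def)
  have owner: "M (U v - 1) = Suc v" "U v = Suc (U v - 1)" if "v \<in> H" for v
  proof -
    from that p0 [of v] have "U v \<noteq> 0"
      by (auto simp: H_def)
    then show "U v = Suc (U v - 1)"
      by simp
    then show "M (U v - 1) = Suc v"
      using inv by metis
  qed
  have cardE: "card E = card H"
    unfolding E_def by (rule card_image, rule inj_onI) (metis owner(1) Suc_inject)
  have DE: "D \<inter> E = {}"
    by (auto simp: D_def E_def dest: owner(1))
  have ED: "D \<union> E \<subseteq> {..<n}"
    using owner(1) edge(1) lt_bounded by (auto simp: D_def E_def) blast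
  \<comment> \<open>Either way the offer of \<open>u\<close> is at least \<open>g\<close>: it is
    \<open>n + 1\<close> for unmatched \<open>u\<close>, and one less than a price above
    \<open>g\<close> for a partner. Then \<open>p v\<close> is at least \<open>g\<close>, and
    strictly larger because \<open>g\<close> is not taken.\<close>
  have up: "v \<in> H" if "u \<in> D \<union> E" "lt u v" for u v
  proof -
    have "g \<le> l u"
      using that(1)
    proof
      assume "u \<in> D"
      then show ?thesis
        using settled [of u] g(2) by (simp add: D_def)
    next
      assume "u \<in> E"
      then obtain w where w: "w \<in> H" "u = U w - 1"
        by (auto simp: E_def)
      with owner(1) [OF w(1)] have "p w = Suc (l u)"
        using edge(2) by simp
      with w(1) show ?thesis
        by (simp add: H_def)
    qed
    then show ?thesis
      using lp [OF that(2)] g(3) [of v] lt_bounded [OF that(2)] by (simp add: H_def)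
  qed
  \<comment> \<open>\<open>M\<close> is a bijection from matched bidders to sold items, so there are
    as many unmatched bidders (tops) as unsold items (bottoms).\<close>
  have free: "card {v. v < n \<and> U v = 0} = card D"
  proof -
    define D' where "D' = {u. u < n \<and> M u \<noteq> 0}"
    define F' where "F' = {v. v < n \<and> U v \<noteq> 0}"
    have 1: "bij_betw (\<lambda>u. M u - 1) D' F'"
    proof (rule bij_betwI [where g = "\<lambda>v. U v - 1"])
      show "(\<lambda>u. M u - 1) \<in> D' \<rightarrow> F'"
      proof
        fix u assume "u \<in> D'"
        then have "M u = Suc (M u - 1)"
          by (simp add: D'_def)
        then show "M u - 1 \<in> F'"
          using inv [of u "M u - 1"] edge(1) [of u "M u - 1"] lt_bounded by (auto simp: F'_def)
      qed
      show "(\<lambda>v. U v - 1) \<in> F' \<rightarrow> D'"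
      proof
        fix v assume "v \<in> F'"
        then have "U v = Suc (U v - 1)"
          by (simp add: F'_def)
        then show "U v - 1 \<in> D'"
          using inv [of "U v - 1" v] edge(1) [of "U v - 1" v] lt_bounded by (auto simp: D'_def)
      qed
      show "U (M u - 1) - 1 = u" if "u \<in> D'" for u
        using that inv [of u "M u - 1"] by (simp add: D'_def)
      show "M (U v - 1) - 1 = v" if "v \<in> F'" for v
        using that inv [of "U v - 1" v] by (simp add: F'_def)
    qed
    then have "card D' = card F'"
      by (rule bij_betw_same_card)
    moreover have "card D + card D' = n"
    proof -
      have "card (D \<union> D') = card D + card D'"
        by (rule card_Un_disjoint) (auto simp: D_def D'_def)
      moreover have "D \<union> D' = {..<n}"
        by (auto simp: D_def D'_def)
      ultimately show ?thesis by simp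
    qed
    moreover have "card {v. v < n \<and> U v = 0} + card F' = n"
    proof -
      have "card ({v. v < n \<and> U v = 0} \<union> F') = card {v. v < n \<and> U v = 0} + card F'"
        by (rule card_Un_disjoint) (auto simp: F'_def)
      moreover have "{v. v < n \<and> U v = 0} \<union> F' = {..<n}"
        by (auto simp: F'_def)
      ultimately show ?thesis by simp
    qed
    ultimately show ?thesis by simp
  qed
  show ?thesis
  proof (rule that [of "(D \<union> E) - H"])
    show "D \<union> E - H \<subseteq> {..<n}"
      using ED by blast
    show "\<not> lt u v" if "u \<in> D \<union> E - H" "v \<in> D \<union> E - H" for u v
      using that up by blast
    \<comment> \<open>Since \<open>card E = card H\<close>, removing \<open>H\<close> costs no more
      than \<open>E\<close> has contributed.\<close>
    have "card (D \<union> E) \<le> card (D \<union> E - H) + card H"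
      using card_Un_le [of "D \<union> E - H" H] card_mono [of "D \<union> E - H \<union> H" "D \<union> E"] fin by fastforce
    moreover have "card (D \<union> E) = card D + card H"
      using card_Un_disjoint [OF fin(2,3) DE] cardE by simp
    ultimately show "card {v. v < n \<and> U v = 0} \<le> card (D \<union> E - H)"
      using free by simp
  qed
qed

section \<open>Chains of a matching\<close>

abbreviation follows :: "(nat \<Rightarrow> nat) \<Rightarrow> nat \<Rightarrow> nat \<Rightarrow> bool" where
  "follows M \<equiv> (\<lambda>u v. M u = Suc v)\<^sup>*\<^sup>*"

text \<open>Descend along \<open>U\<close>: each predecessor has strictly more elements above it,
  and \<open>above\<close> never exceeds \<open>n\<close>, so the descent stops at an element with
  \<open>U u = 0\<close>.\<close>

lemma matching_bottom:
  assumes m: "matching M U l p" and "v < n"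
  shows "\<exists>u<n. U u = 0 \<and> follows M u v"
  using \<open>v < n\<close>
proof (induction "n - above v" arbitrary: v rule: less_induct)
  case less
  show ?case
  proof (cases "U v")
    case 0
    then show ?thesis
      using less.prems by blast
  next
    case (Suc w)
    then have w: "M w = Suc v" "lt w v"
      using m unfolding matching_def by blast+
    then have "n - above w < n - above v" "w < n"
      using above_less [of w v] above_le [of w] lt_bounded [of w v] by auto
    then obtain u where "u < n" "U u = 0" "follows M u w"
      using less.hyps [of w] by blast
    with w(1) show ?thesis
      by (meson rtranclp.rtrancl_into_rtrancl)
  qed
qed

text \<open>\<open>x\<close> is the active bidder, the only one up to \<open>i\<close> that is
  neither matched nor has given up (offer \<open>n + 1\<close>); bidders beyond \<open>i\<close>
  have not entered. \<open>y\<close> is the next item to examine, those before it being too dear for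
  \<open>x\<close>. At the end \<open>x = n\<close> is a dummy bidder.\<close>

definition auction ::
    "nat \<Rightarrow> nat \<Rightarrow> nat \<Rightarrow> (nat \<Rightarrow> nat) \<Rightarrow> (nat \<Rightarrow> nat) \<Rightarrow> (nat \<Rightarrow> nat) \<Rightarrow> (nat \<Rightarrow> nat) \<Rightarrow> bool" where
  "auction i x y M U l p \<longleftrightarrow>
     matching M U l p \<and> i \<le> n \<and> x \<le> i \<and> y \<le> n \<and>
     (\<forall>v<y. lt x v \<longrightarrow> l x < p v) \<and>
     (i = n \<longrightarrow> x = n) \<and> M x = 0 \<and> l x \<le> n \<and> (\<forall>u>i. M u = 0 \<and> l u = 0) \<and>
     (\<forall>u\<le>i. u \<noteq> x \<longrightarrow> M u \<noteq> 0 \<or> l u = Suc n)"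

lemma auction_done:
  assumes "auction i x y M U l p" and "\<not> i < n"
  shows "matching M U l p" and "u < n \<Longrightarrow> M u \<noteq> 0 \<or> l u = Suc n"
  using assms by (auto simp: auction_def)

text \<open>Each rise of an offer or price and each entry of a bidder is weighted by
  \<open>Suc n\<close>, enough to pay for resetting the pointer \<open>y\<close> to 0.\<close>

definition auction_potential :: "nat \<Rightarrow> nat \<Rightarrow> (nat \<Rightarrow> nat) \<Rightarrow> (nat \<Rightarrow> nat) \<Rightarrow> nat" where
  "auction_potential i y l p =
     ((\<Sum>u<n. Suc n - l u) + (\<Sum>v<n. Suc n - p v) + (n - i)) * Suc n + (n - y)"

lemma auction_init: "auction 0 0 0 (\<lambda>_. 0) (\<lambda>_. 0) (\<lambda>_. 0) (\<lambda>_. 0)"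
  by (auto simp: auction_def matching_def)

lemma potential_mono:
  assumes "a' < (a::nat)"
  shows "a' * Suc n + (n - y') < a * Suc n + (n - y)"
proof -
  have "Suc a' * Suc n \<le> a * Suc n"
    using assms by (intro mult_le_mono1) simp
  then show ?thesis by simp
qed

lemma auction_skip:
  assumes "auction i x y M U l p" and "y < n" and "\<not> (lt x y \<and> p y \<le> l x)"
  shows "auction i x (Suc y) M U l p \<and> auction_potential i (Suc y) l p < auction_potential i y l p"
  using assms by (auto simp: auction_def auction_potential_def less_Suc_eq)

lemma sum_diff_less:
  assumes "x < n" and "a x < N"
  shows "(\<Sum>u<n. N - (a(x := Suc (a x))) u) < (\<Sum>u<n. N - (a u :: nat))"
  by (rule sum_strict_mono_ex1) (use assms in auto)

text \<open>\<open>x\<close> is unmatched, so no equation \<open>p v = Suc (l u)\<close> involves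
  its offer, and the strict inequality leaves room to raise the offer by one.\<close>

lemma matching_raise:
  assumes "matching M U l p" and "M x = 0" and "l x \<le> n" and "\<And>v. lt x v \<Longrightarrow> l x < p v"
  shows "matching M U (l(x := Suc (l x))) p"
proof -
  have "M u = Suc v \<Longrightarrow> u \<noteq> x" for u v
    using assms(2) by auto
  then show ?thesis
    using assms unfolding matching_def by (simp add: Suc_leI)
qed

text \<open>With the pointer at \<open>n\<close>, all items above \<open>x\<close> cost more than it
  offers, which is what \<open>matching_raise\<close> asks for.\<close>

lemma auction_raise:
  assumes "auction i x n M U l p" and "i < n" and "l x < n"
  shows "auction i x 0 M U (l(x := Suc (l x))) p"
    and "auction_potential i 0 (l(x := Suc (l x))) p < auction_potential i n l p"
proof -
  have "x < n" "l x < Suc n"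
    using assms by (auto simp: auction_def)
  from sum_diff_less [of x l "Suc n", OF this]
  show "auction_potential i 0 (l(x := Suc (l x))) p < auction_potential i n l p"
    unfolding auction_potential_def by (intro potential_mono) simp
  show "auction i x 0 M U (l(x := Suc (l x))) p"
    using assms lt_bounded by (auto simp: auction_def intro!: matching_raise)
qed

text \<open>At offer \<open>n + 1\<close> the bidder gives up for good and stays the top of its
  chain; the next bidder enters.\<close>

lemma auction_drop:
  assumes "auction i x n M U l p" and "i < n" and "l x = n"
  shows "auction (Suc i) (Suc i) 0 M U (l(x := Suc n)) p"
    and "auction_potential (Suc i) 0 (l(x := Suc n)) p < auction_potential i n l p"
proof -
  have "x < n" "l x < Suc n"
    using assms by (auto simp: auction_def)
  from sum_diff_less [of x l "Suc n", OF this] assms(3)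
  show "auction_potential (Suc i) 0 (l(x := Suc n)) p < auction_potential i n l p"
    unfolding auction_potential_def by (intro potential_mono) simp
  have "matching M U (l(x := Suc (l x))) p"
    by (rule matching_raise) (use assms lt_bounded in \<open>auto simp: auction_def\<close>)
  then show "auction (Suc i) (Suc i) 0 M U (l(x := Suc n)) p"
    using assms by (auto simp: auction_def le_Suc_eq)
qed

text \<open>The invariant gives \<open>l x \<le> p y\<close>, so offer and price coincide, and after
  the increment the price is one more than the offer, as for every matched pair.\<close>

lemma matching_bid:
  assumes m: "matching M U l p" and "M x = 0" "l x \<le> n" "lt x y" "p y \<le> l x" "U y = 0"
  shows "matching (M(x := Suc y)) (U(y := Suc x)) l (p(y := Suc (p y)))" (is "matching ?M ?U _ ?p")
proof -
  note inv = matching_inverse [OF m] and edge = matching_edge [OF m]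
    and p0 = matching_free [OF m] and lp = matching_offer [OF m]
  have [simp]: "l x = p y"
    using lp [OF assms(4)] assms(5) by simp
  have [simp]: "M u \<noteq> Suc y" "U u \<noteq> Suc x" for u
    using assms inv by (metis nat.distinct(1), metis nat.distinct(1))
  show ?thesis
    unfolding matching_def
  proof (intro conjI)
    show "\<forall>u v. (?M u = Suc v) = (?U v = Suc u)"
      using inv assms(6) by auto
    show "\<forall>u v. ?M u = Suc v \<longrightarrow> lt u v \<and> ?p v = Suc (l u) \<and> l u \<le> n"
      using edge assms(3,4) by simp
    show "\<forall>v. ?U v = 0 \<longrightarrow> ?p v = 0"
      using p0 by simp
    show "\<forall>u v. lt u v \<longrightarrow> l u \<le> ?p v"
      using lp by (simp add: le_SucI)
    show "\<forall>u. l u \<le> Suc n"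
      using m by (simp add: matching_def)
  qed
qed

text \<open>As for a free item, but the former owner \<open>z\<close> loses \<open>y\<close>. It
  keeps its offer, which stays admissible because the price only rises.\<close>

lemma matching_outbid:
  assumes m: "matching M U l p" and "M x = 0" "l x \<le> n" "lt x y" "p y \<le> l x" "U y = Suc z"
  shows "matching (M(x := Suc y, z := 0)) (U(y := Suc x)) l (p(y := Suc (p y)))"
    (is "matching ?M ?U _ ?p")
proof -
  note inv = matching_inverse [OF m] and edge = matching_edge [OF m]
    and p0 = matching_free [OF m] and lp = matching_offer [OF m]
  have [simp]: "l x = p y"
    using lp [OF assms(4)] assms(5) by simp
  have z: "M z = Suc y"
    using assms inv by blast
  have [simp]: "x \<noteq> z"
    using z assms by auto
  have [simp]: "M u = Suc y \<longleftrightarrow> u = z" "U u \<noteq> Suc x" "U u = Suc z \<longleftrightarrow> u = y"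
      "U y = Suc u \<longleftrightarrow> u = z" for u
    using assms inv z by (metis Suc_inject, metis nat.distinct(1), metis Suc_inject, metis Suc_inject)
  show ?thesis
    unfolding matching_def
  proof (intro conjI)
    show "\<forall>u v. (?M u = Suc v) = (?U v = Suc u)"
      using inv assms(6) by auto
    show "\<forall>u v. ?M u = Suc v \<longrightarrow> lt u v \<and> ?p v = Suc (l u) \<and> l u \<le> n"
      using edge assms(3,4) by simp
    show "\<forall>v. ?U v = 0 \<longrightarrow> ?p v = 0"
      using p0 by simp
    show "\<forall>u v. lt u v \<longrightarrow> l u \<le> ?p v"
      using lp by (simp add: le_SucI)
    show "\<forall>u. l u \<le> Suc n"
      using m by (simp add: matching_def)
  qed
qed

lemma auction_bid:
  assumes a: "auction i x y M U l p" and "i < n" "lt x y" "p y \<le> l x" "U y = 0"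
  shows "auction (Suc i) (Suc i) 0 (M(x := Suc y)) (U(y := Suc x)) l (p(y := Suc (p y)))"
    and "auction_potential (Suc i) 0 l (p(y := Suc (p y))) < auction_potential i y l p"
proof -
  have "y < n" "p y < Suc n"
    using assms lt_bounded by (auto simp: auction_def)
  from sum_diff_less [of y p "Suc n", OF this]
  show "auction_potential (Suc i) 0 l (p(y := Suc (p y))) < auction_potential i y l p"
    unfolding auction_potential_def by (intro potential_mono) simp
  have "matching (M(x := Suc y)) (U(y := Suc x)) l (p(y := Suc (p y)))"
    using assms by (auto simp: auction_def intro!: matching_bid)
  then show "auction (Suc i) (Suc i) 0 (M(x := Suc y)) (U(y := Suc x)) l (p(y := Suc (p y)))"
    using assms by (auto simp: auction_def le_Suc_eq)
qed

lemma auction_outbid: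
  assumes a: "auction i x y M U l p" and "i < n" "lt x y" "p y \<le> l x" "U y = Suc z"
  shows "auction i z 0 (M(x := Suc y, z := 0)) (U(y := Suc x)) l (p(y := Suc (p y)))"
    and "auction_potential i 0 l (p(y := Suc (p y))) < auction_potential i y l p"
proof -
  have "y < n" "p y < Suc n"
    using assms lt_bounded by (auto simp: auction_def)
  from sum_diff_less [of y p "Suc n", OF this]
  show "auction_potential i 0 l (p(y := Suc (p y))) < auction_potential i y l p"
    unfolding auction_potential_def by (intro potential_mono) simp
  have 1: "matching (M(x := Suc y, z := 0)) (U(y := Suc x)) l (p(y := Suc (p y)))"
    using assms by (auto simp: auction_def intro!: matching_outbid)
  have m: "matching M U l p"
    using a by (simp add: auction_def)
  have z: "M z = Suc y"
    using matching_inverse [OF m] assms(5) by blast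
  \<comment> \<open>The clause \<open>l u \<le> n\<close> for matched bidders in
    \<open>matching\<close> is what allows the displaced \<open>z\<close> to bid again.\<close>
  then have "l z \<le> n"
    using matching_edge(3) [OF m] by blast
  moreover have *: "M x = 0" "\<And>u. i < u \<Longrightarrow> M u = 0"
    using a by (simp_all add: auction_def)
  have "\<not> i < z"
    using *(2) [of z] z by auto
  moreover have "z \<noteq> x"
    using *(1) z by auto
  ultimately show "auction i z 0 (M(x := Suc y, z := 0)) (U(y := Suc x)) l (p(y := Suc (p y)))"
    using assms 1 by (auto simp: auction_def)
qed

end

section \<open>Search for an embedding\<close>

definition radix_value :: "nat \<Rightarrow> nat \<Rightarrow> (nat \<Rightarrow> nat) \<Rightarrow> nat" where
  "radix_value b k a = (\<Sum>i<k. a i * b ^ i)"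

text \<open>Both sides are sums because subtraction of naturals truncates.\<close>

lemma radix_value_update:
  assumes "i < k"
  shows "radix_value b k (a(i := c)) + a i * b ^ i = radix_value b k a + c * b ^ i"
proof -
  have "radix_value b k f = f i * b ^ i + (\<Sum>j\<in>{..<k} - {i}. f j * b ^ j)" for f
    unfolding radix_value_def using assms by (subst sum.remove [of _ i]) auto
  note this [of a] this [of "a(i := c)"]
  moreover have "(\<Sum>j\<in>{..<k} - {i}. (a(i := c)) j * b ^ j) = (\<Sum>j\<in>{..<k} - {i}. a j * b ^ j)"
    by (rule sum.cong) auto
  ultimately show ?thesis by simp
qed

lemma radix_value_less: "(\<And>i. i < k \<Longrightarrow> a i < b) \<Longrightarrow> radix_value b k a < b ^ k"
proof (induction k)
  case (Suc k)
  have "Suc (a k) \<le> b"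
    using Suc.prems [of k] by simp
  have "radix_value b k a < b ^ k"
    using Suc by simp
  then have "radix_value b (Suc k) a < Suc (a k) * b ^ k"
    by (simp add: radix_value_def)
  also have "\<dots> \<le> b ^ Suc k"
    unfolding power_Suc by (rule mult_le_mono1) fact
  finally show ?case .
qed (simp add: radix_value_def)

text \<open>Quotients by \<open>b ^ k\<close> isolate the top digit, as the lower digits contribute
  less than \<open>b ^ k\<close>.\<close>

lemma radix_value_inject:
  assumes "\<And>i. i < k \<Longrightarrow> a i < b" "\<And>i. i < k \<Longrightarrow> c i < b"
    and "radix_value b k a = radix_value b k c" and "i < k"
  shows "a i = c i"
  using assms
proof (induction k)
  case (Suc k)
  have less: "radix_value b k a < b ^ k" "radix_value b k c < b ^ k"
    using Suc.prems by (auto intro: radix_value_less)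
  have eq: "radix_value b k a + a k * b ^ k = radix_value b k c + c k * b ^ k"
    using Suc.prems(3) by (simp add: radix_value_def)
  have "b ^ k \<noteq> 0"
    using less by linarith
  have "a k = (radix_value b k a + a k * b ^ k) div b ^ k"
    using div_mult_self1 [OF \<open>b ^ k \<noteq> 0\<close>] less(1) by simp
  also have "\<dots> = c k"
    using div_mult_self1 [OF \<open>b ^ k \<noteq> 0\<close>] less(2) by (simp add: eq)
  finally have "a k = c k" .
  with Suc eq show ?case
    by (auto simp: less_Suc_eq)
qed simp

section \<open>Least solution for a fixed choice of chains\<close>

context index_poset
begin

definition index_embedding :: "nat \<Rightarrow> (nat \<Rightarrow> nat \<Rightarrow> bool) \<Rightarrow> (nat \<Rightarrow> nat) \<Rightarrow> bool" where
  "index_embedding k q e \<longleftrightarrow>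
     (\<forall>i<k. e i < n) \<and> (\<forall>i<k. \<forall>j<k. q i j \<longleftrightarrow> le (e i) (e j))"

lemma follows_le:
  assumes "matching M U l p" and "follows M u v" and "u < n"
  shows "le u v"
  using assms(2)
proof induction
  case base
  then show ?case
    using le_refl assms(3) by blast
next
  case (step v w)
  then show ?case
    using matching_edge(1) [OF assms(1)] le_trans unfolding lt_def by blast
qed

lemma follows_next:
  assumes "follows M u v" and "u \<noteq> v"
  shows "\<exists>w. M u = Suc w \<and> follows M w v"
  using assms by (metis (mono_tags, lifting) converse_rtranclpE)

definition blocked :: "nat \<Rightarrow> (nat \<Rightarrow> nat \<Rightarrow> bool) \<Rightarrow> (nat \<Rightarrow> nat) \<Rightarrow> nat \<Rightarrow> bool" where
  "blocked k q L v \<longleftrightarrow> v < k \<and>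
     (\<exists>u<k. q u v \<and> \<not> le (L u) (L v) \<or> \<not> q v u \<and> le (L v) (L u))"

text \<open>Suppose \<open>L v = e v\<close>. If \<open>q u v\<close>, then \<open>L u\<close> is
  below \<open>e u\<close>, hence below \<open>e v = L v\<close>, and the positions were in order
  after all. If \<open>q v u\<close> fails, then \<open>e v = L v\<close> is below
  \<open>L u\<close>, hence below \<open>e u\<close>, which contradicts the embedding. So
  \<open>e v\<close> lies further up the chain.\<close>

lemma blocked_advance:
  assumes m: "matching M U l p" and "blocked k q L v" and e: "index_embedding k q e"
    and f: "\<And>i. i < k \<Longrightarrow> follows M (L i) (e i)" and "\<And>i. i < k \<Longrightarrow> L i < n"
  shows "\<exists>w. M (L v) = Suc w \<and> follows M w (e v)"
proof (rule follows_next)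
  obtain u where u: "u < k" "v < k"
    and cases: "q u v \<and> \<not> le (L u) (L v) \<or> \<not> q v u \<and> le (L v) (L u)"
    using assms(2) unfolding blocked_def by blast
  show "follows M (L v) (e v)"
    using f u by blast
  have "le (L u) (e u)"
    using follows_le [OF m f] u assms(5) by blast
  with cases show "L v \<noteq> e v"
    using e u le_trans unfolding index_embedding_def by metis
qed

text \<open>\<open>(i, j)\<close> is the next pair to check in row-major order, and \<open>h\<close>
  signals failure. The last clause keeps \<open>L\<close> below every solution above
  \<open>L0\<close>. The guard \<open>0 < n\<close> covers empty \<open>P\<close>, where no position
  is valid.\<close>

definition scan :: "nat \<Rightarrow> (nat \<Rightarrow> nat \<Rightarrow> bool) \<Rightarrow> (nat \<Rightarrow> nat) \<Rightarrow> (nat \<Rightarrow> nat) \<Rightarrow>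
    nat \<Rightarrow> nat \<Rightarrow> nat \<Rightarrow> (nat \<Rightarrow> nat) \<Rightarrow> bool" where
  "scan k q M L0 i j h L \<longleftrightarrow>
     i \<le> k \<and> j \<le> k \<and> (0 < n \<longrightarrow> (\<forall>i<k. L i < n)) \<and>
     (h = 0 \<longrightarrow> (\<forall>i'<k. \<forall>j'<k. i' < i \<or> i' = i \<and> j' < j \<longrightarrow> (q i' j' \<longleftrightarrow> le (L i') (L j')))) \<and>
     (\<forall>e. index_embedding k q e \<and> (\<forall>i<k. follows M (L0 i) (e i)) \<longrightarrow>
        h = 0 \<and> (\<forall>i<k. follows M (L i) (e i)))"

text \<open>Lexicographic: one upward move outweighs restarting the check at \<open>(0, 0)\<close>,
  since \<open>k * Suc k + k < Suc k * Suc k\<close>.\<close>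

definition scan_potential :: "nat \<Rightarrow> nat \<Rightarrow> nat \<Rightarrow> (nat \<Rightarrow> nat) \<Rightarrow> nat" where
  "scan_potential k i j L = (\<Sum>i<k. above (L i)) * (Suc k * Suc k) + (k - i) * Suc k + (k - j)"

lemma scan_init: "(0 < n \<Longrightarrow> \<forall>i<k. L i < n) \<Longrightarrow> scan k q M L 0 0 0 L"
  by (auto simp: scan_def)

lemma scan_step:
  assumes "scan k q M L0 i j 0 L" and "i < k" "j < k" and "q i j \<longleftrightarrow> le (L i) (L j)"
  shows "scan k q M L0 i (Suc j) 0 L"
    and "scan_potential k i (Suc j) L < scan_potential k i j L"
  using assms by (auto simp: scan_def scan_potential_def less_Suc_eq)

lemma scan_row:
  assumes "scan k q M L0 i j 0 L" and "i < k" "\<not> j < k"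
  shows "scan k q M L0 (Suc i) 0 0 L"
    and "scan_potential k (Suc i) 0 L < scan_potential k i j L"
proof -
  show "scan k q M L0 (Suc i) 0 0 L"
    using assms by (auto simp: scan_def less_Suc_eq)
  have "(k - i) * Suc k = (k - Suc i) * Suc k + Suc k"
    using assms(2) by (metis Suc_diff_Suc add.commute mult_Suc)
  with assms show "scan_potential k (Suc i) 0 L < scan_potential k i j L"
    by (simp add: scan_potential_def)
qed

text \<open>The blocked element sits at the top of its chain, while a solution would give it a
  successor by \<open>blocked_advance\<close>.\<close>

lemma scan_fail:
  assumes "matching M U l p" and "scan k q M L0 i j 0 L" and "blocked k q L v" and "M (L v) = 0"
  shows "scan k q M L0 i j 1 L"
proof -
  have "v < k"
    using assms(3) by (simp add: blocked_def)
  have "\<not> (index_embedding k q e \<and> (\<forall>i<k. follows M (L0 i) (e i)))" for e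
  proof
    assume e: "index_embedding k q e \<and> (\<forall>i<k. follows M (L0 i) (e i))"
    \<comment> \<open>A solution maps \<open>v\<close> below \<open>n\<close>, which discharges the
      guard in \<open>scan\<close>.\<close>
    then have "0 < n"
      using \<open>v < k\<close> unfolding index_embedding_def by auto
    with e assms(2) blocked_advance [OF assms(1,3)] assms(4) show False
      unfolding scan_def by (metis nat.distinct(1))
  qed
  then show ?thesis
    using assms(2) by (simp add: scan_def)
qed

text \<open>The move may spoil pairs already checked, hence the restart at \<open>(0, 0)\<close>. By
  \<open>blocked_advance\<close> no solution is lost.\<close>

lemma scan_advance:
  assumes m: "matching M U l p" and s: "scan k q M L0 i j 0 L" and b: "blocked k q L v"
    and w: "M (L v) = Suc w"
  shows "scan k q M L0 0 0 0 (L(v := w))"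
    and "scan_potential k 0 0 (L(v := w)) < scan_potential k i j L"
proof -
  have v: "v < k"
    using b by (simp add: blocked_def)
  have lt: "lt (L v) w"
    using matching_edge(1) [OF m w] .
  then have n: "w < n" "L i < n" if "i < k" for i
    using that s lt_bounded [OF lt] unfolding scan_def by auto
  have "follows M ((L(v := w)) i) (e i)"
    if "index_embedding k q e" "\<forall>i<k. follows M (L0 i) (e i)" "i < k" for e i
  proof -
    have f: "\<And>i. i < k \<Longrightarrow> follows M (L i) (e i)"
      using s that unfolding scan_def by blast
    show ?thesis
      using blocked_advance [OF m b that(1) f n(2)] f w that(3) by auto
  qed
  then show "scan k q M L0 0 0 0 (L(v := w))"
    unfolding scan_def using n by auto
  have "(\<Sum>i<k. above ((L(v := w)) i)) < (\<Sum>i<k. above (L i))"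
    by (rule sum_strict_mono_ex1) (use v above_less [OF lt] in auto)
  then have "Suc (\<Sum>i<k. above ((L(v := w)) i)) * (Suc k * Suc k) \<le> (\<Sum>i<k. above (L i)) * (Suc k * Suc k)"
    by (intro mult_le_mono1) simp
  then show "scan_potential k 0 0 (L(v := w)) < scan_potential k i j L"
    by (simp add: scan_potential_def algebra_simps)
qed

text \<open>Reflexivity of \<open>q\<close> gives \<open>le (L i) (L i)\<close> on the diagonal, and
  \<open>le_bounded\<close> turns this into \<open>L i < n\<close> without appeal to the guard
  \<open>0 < n\<close>.\<close>

lemma scan_accept:
  assumes "scan k q M L0 i j 0 L" and "\<not> i < k" and "\<And>i. i < k \<Longrightarrow> q i i"
  shows "index_embedding k q L"
proof -
  have "q i' j' \<longleftrightarrow> le (L i') (L j')" if "i' < k" "j' < k" for i' j'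
    using assms(1,2) that unfolding scan_def by auto
  then show ?thesis
    using assms(3) le_bounded unfolding index_embedding_def by blast
qed

lemma scan_reject:
  assumes "scan k q M L0 i j h L" and "h \<noteq> 0"
  shows "\<not> (\<exists>e. index_embedding k q e \<and> (\<forall>i<k. follows M (L0 i) (e i)))"
  using assms unfolding scan_def by blast

text \<open>The digits \<open>a\<close> assign chains, given by their bottoms in \<open>B\<close>,
  to the elements of \<open>Q\<close>; \<open>d\<close> signals the end and \<open>r\<close> is the
  answer. While \<open>d = 0\<close>, all assignments of smaller value than \<open>a\<close> have
  been ruled out.\<close>

definition search :: "nat \<Rightarrow> (nat \<Rightarrow> nat \<Rightarrow> bool) \<Rightarrow> (nat \<Rightarrow> nat) \<Rightarrow> (nat \<Rightarrow> nat) \<Rightarrow> nat \<Rightarrow>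
    (nat \<Rightarrow> nat) \<Rightarrow> nat \<Rightarrow> nat \<Rightarrow> bool" where
  "search k q M B W a d r \<longleftrightarrow>
     (\<forall>i<k. a i < W) \<and>
     (d = 0 \<longrightarrow> r = 0 \<and> (\<forall>b e. (\<forall>i<k. b i < W) \<and> radix_value W k b < radix_value W k a \<and>
        index_embedding k q e \<longrightarrow> \<not> (\<forall>i<k. follows M (B (b i)) (e i)))) \<and>
     (d \<noteq> 0 \<longrightarrow> (r = 1 \<longleftrightarrow> (\<exists>e. index_embedding k q e)))"

lemma search_init: "0 < W \<Longrightarrow> search k q M B W (\<lambda>_. 0) 0 0"
  by (simp add: search_def radix_value_def)

lemma search_accept:
  assumes "search k q M B W a 0 r" and "index_embedding k q e"
  shows "search k q M B W a 1 1"
  using assms unfolding search_def by auto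

lemma search_excluded:
  assumes s: "search k q M B W a 0 r"
    and no: "\<not> (\<exists>e. index_embedding k q e \<and> (\<forall>i<k. follows M (B (a i)) (e i)))"
    and b: "\<forall>i<k. b i < W" "radix_value W k b \<le> radix_value W k a" and e: "index_embedding k q e"
  shows "\<not> (\<forall>i<k. follows M (B (b i)) (e i))"
proof (cases "radix_value W k b = radix_value W k a")
  case True
  have "b i = a i" if "i < k" for i
    using radix_value_inject [of k b W a i] True s b(1) that unfolding search_def by blast
  with no e show ?thesis
    by (metis (mono_tags, lifting))
next
  case False
  then have "radix_value W k b < radix_value W k a"
    using b by simp
  with s b e show ?thesis
    unfolding search_def by blast
qed

lemma search_next:
  assumes s: "search k q M B W a 0 r"
    and no: "\<not> (\<exists>e. index_embedding k q e \<and> (\<forall>i<k. follows M (B (a i)) (e i)))"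
    and "\<forall>i<k. a' i < W" "radix_value W k a' = Suc (radix_value W k a)"
  shows "search k q M B W a' 0 r"
  using assms(3,4) search_excluded [OF s no] s unfolding search_def by simp

text \<open>The value of \<open>a\<close> is the largest possible one, so every assignment is ruled
  out, whereas by \<open>complete\<close> any embedding would induce one.\<close>

lemma search_finish:
  assumes s: "search k q M B W a 0 r"
    and no: "\<not> (\<exists>e. index_embedding k q e \<and> (\<forall>i<k. follows M (B (a i)) (e i)))"
    and "\<forall>i<k. a' i < W" "W ^ k = Suc (radix_value W k a)"
    and complete: "\<And>v. v < n \<Longrightarrow> \<exists>j<W. follows M (B j) v"
  shows "search k q M B W a' 1 r"
proof -
  have "\<not> index_embedding k q e" for e
  proof
    assume e: "index_embedding k q e"
    then have "\<forall>i<k. \<exists>j<W. follows M (B j) (e i)"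
      using complete unfolding index_embedding_def by blast
    then obtain b where b: "\<forall>i<k. b i < W \<and> follows M (B (b i)) (e i)"
      by metis
    then have "radix_value W k b < W ^ k"
      by (intro radix_value_less) blast
    with search_excluded [OF s no _ _ e, of b] b assms(4) show False
      by simp
  qed
  with s assms(3) show ?thesis
    unfolding search_def by simp
qed

end

text \<open>The state of incrementing \<open>a0\<close>: the digits below \<open>i\<close> are
  cleared and a carry of weight \<open>b ^ i\<close> is still to be added.\<close>

definition carry :: "nat \<Rightarrow> nat \<Rightarrow> (nat \<Rightarrow> nat) \<Rightarrow> nat \<Rightarrow> (nat \<Rightarrow> nat) \<Rightarrow> bool" where
  "carry b k a0 i a \<longleftrightarrow> i \<le> k \<and> (\<forall>j<k. a j < b) \<and> (\<forall>j<i. a j = 0) \<and>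
     radix_value b k a + b ^ i = Suc (radix_value b k a0)"

text \<open>The digit is \<open>b - 1\<close>, so clearing it turns the carry \<open>b ^ i\<close>
  into \<open>b ^ Suc i\<close>.\<close>

lemma carry_step:
  assumes "carry b k a0 i a" and "i < k" and "\<not> Suc (a i) < b"
  shows "carry b k a0 (Suc i) (a(i := 0))"
proof -
  have "Suc (a i) = b"
    using assms by (auto simp: carry_def le_less_Suc_eq not_less Suc_le_eq intro: antisym)
  then have "b ^ Suc i = a i * b ^ i + b ^ i"
    by (metis add.commute mult_Suc power_Suc)
  with radix_value_update [OF assms(2), of b a 0] assms show ?thesis
    by (auto simp: carry_def less_Suc_eq)
qed

lemma carry_increment:
  assumes "carry b k a0 i a" and "i < k" and "Suc (a i) < b"
  shows "radix_value b k (a(i := Suc (a i))) = Suc (radix_value b k a0)"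
  using radix_value_update [OF assms(2), of b a "Suc (a i)"] assms(1) by (simp add: carry_def)

lemma carry_overflow:
  assumes "carry b k a0 i a" and "\<not> i < k"
  shows "b ^ k = Suc (radix_value b k a0)"
  using assms by (auto simp: carry_def radix_value_def)

section \<open>Programs\<close>

notation Seq (infixr ";;" 60)

abbreviation (input) Var :: "vname \<Rightarrow> aexp" where
  "Var x \<equiv> Cell x (Const 0)"

abbreviation (input) assign :: "vname \<Rightarrow> aexp \<Rightarrow> com" (infix "::=" 65) where
  "x ::= a \<equiv> Assign x (Const 0) a"

abbreviation (input) incr :: "vname \<Rightarrow> com" where
  "incr x \<equiv> x ::= Plus (Var x) (Const 1)"

abbreviation (input) pos :: "aexp \<Rightarrow> bexp" where
  "pos a \<equiv> Less (Const 0) a"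

text \<open>Multiplication is not a machine operation, so the row starts \<open>u * m\<close> of a
  matrix are tabulated by repeated addition.\<close>

definition row_offsets :: "vname \<Rightarrow> vname \<Rightarrow> com" where
  "row_offsets r m =
     ''i'' ::= Const 0 ;;
     While (Less (Var ''i'') (Var m))
       (Assign r (Plus (Var ''i'') (Const 1)) (Plus (Cell r (Var ''i'')) (Var m)) ;;
        incr ''i'')"

lemma runs_row_offsets:
  assumes "s r 0 = 0" and "distinct [r, m, ''i'']"
  shows "runs (row_offsets r m) s (40 * (s m 0 + 1))
    (\<lambda>s'. (\<forall>u\<le>s m 0. s' r u = u * s m 0) \<and> (\<forall>x. x \<notin> {r, ''i''} \<longrightarrow> s' x = s x))"
  unfolding row_offsets_def
proof (rule runs_weaken [OF runs_prefix], simp)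
  let ?I = "\<lambda>s'. s' ''i'' 0 \<le> s m 0 \<and> s' m = s m \<and> (\<forall>u\<le>s' ''i'' 0. s' r u = u * s m 0)"
  let ?c = "Assign r (Plus (Var ''i'') (Const 1)) (Plus (Cell r (Var ''i'')) (Var m)) ;; incr ''i''"
  let ?s = "effect (''i'' ::= Const 0) s"
  show "runs (While (Less (Var ''i'') (Var m)) ?c) ?s (35 * (s m 0 + 1))
    (\<lambda>s'. (\<forall>u\<le>s m 0. s' r u = u * s m 0) \<and> (\<forall>x. x \<notin> {r, ''i''} \<longrightarrow> s' x = s x))"
    by (rule runs_While_loop_free [where I = ?I and m = "\<lambda>s'. s m 0 - s' ''i'' 0"])
      (use assms in \<open>auto simp: le_Suc_eq\<close>)
qed (use assms in auto)

text \<open>The branches realise \<open>auction_outbid\<close>, \<open>auction_bid\<close>,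
  \<open>auction_skip\<close>, \<open>auction_drop\<close> and \<open>auction_raise\<close>, in this
  order. \<open>z\<close> saves the old owner, shifted as in \<open>U\<close>.\<close>

definition auction_round :: com where
  "auction_round =
     Cond (Less (Var ''y'') (Var ''n''))
       (Cond (Conj (Conj (pos (Cell ''P'' (Plus (Cell ''R'' (Var ''x'')) (Var ''y''))))
                         (Neg (pos (Cell ''P'' (Plus (Cell ''R'' (Var ''y'')) (Var ''x''))))))
                   (Neg (Less (Cell ''l'' (Var ''x'')) (Cell ''p'' (Var ''y'')))))
         (Assign ''M'' (Var ''x'') (Plus (Var ''y'') (Const 1)) ;;
          Assign ''p'' (Var ''y'') (Plus (Cell ''p'' (Var ''y'')) (Const 1)) ;;
          ''z'' ::= Cell ''U'' (Var ''y'') ;;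
          Assign ''U'' (Var ''y'') (Plus (Var ''x'') (Const 1)) ;;
          ''y'' ::= Const 0 ;;
          Cond (pos (Var ''z''))
            (''x'' ::= Minus (Var ''z'') (Const 1) ;;
             Assign ''M'' (Var ''x'') (Const 0))
            (incr ''i'' ;; ''x'' ::= Var ''i''))
         (incr ''y''))
       (Assign ''l'' (Var ''x'') (Plus (Cell ''l'' (Var ''x'')) (Const 1)) ;;
        ''y'' ::= Const 0 ;;
        Cond (Less (Var ''n'') (Cell ''l'' (Var ''x'')))
          (incr ''i'' ;; ''x'' ::= Var ''i'')
          Skip)"

definition chains :: com where
  "chains = While (Less (Var ''i'') (Var ''n'')) auction_round"

context index_poset
begin

lemma auction_bounds:
  assumes "auction i x y M U l p" and "i < n"
  shows "x < n" "y \<le> n" "l x \<le> n"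
  using assms by (auto simp: auction_def)

abbreviation auction_state :: "state \<Rightarrow> bool" where
  "auction_state s \<equiv>
     auction (s ''i'' 0) (s ''x'' 0) (s ''y'' 0) (s ''M'') (s ''U'') (s ''l'') (s ''p'')"

abbreviation auction_measure :: "state \<Rightarrow> nat" where
  "auction_measure s \<equiv> auction_potential (s ''i'' 0) (s ''y'' 0) (s ''l'') (s ''p'')"

lemma auction_round_correct:
  assumes inv: "auction_state s" and i: "s ''i'' 0 < n" and n: "s ''n'' 0 = n"
    and le: "\<And>u v. u < n \<Longrightarrow> v < n \<Longrightarrow> 0 < s ''P'' (s ''R'' u + v) \<longleftrightarrow> le u v"
  shows "auction_state (effect auction_round s) \<and>
    auction_measure (effect auction_round s) < auction_measure s"
proof -
  have x: "s ''x'' 0 < n" "s ''y'' 0 \<le> n" "s ''l'' (s ''x'' 0) \<le> n"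
    using auction_bounds [OF inv i] by simp_all
  show ?thesis
  proof (cases "s ''y'' 0 < n")
    case y: True
    have lt: "lt (s ''x'' 0) (s ''y'' 0) \<longleftrightarrow>
        0 < s ''P'' (s ''R'' (s ''x'' 0) + s ''y'' 0) \<and>
        \<not> 0 < s ''P'' (s ''R'' (s ''y'' 0) + s ''x'' 0)"
      by (simp only: lt_def le [OF x(1) y] le [OF y x(1)])
    show ?thesis
    proof (cases "lt (s ''x'' 0) (s ''y'' 0) \<and> s ''p'' (s ''y'' 0) \<le> s ''l'' (s ''x'' 0)")
      case True
      show ?thesis
      proof (cases "s ''U'' (s ''y'' 0)")
        case 0
        from auction_bid [OF inv i _ _ this] True show ?thesis
          using y lt n 0 by (simp add: auction_round_def)
      next
        case (Suc z)
        from auction_outbid [OF inv i _ _ this] True show ?thesis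
          using y lt n Suc by (simp add: auction_round_def)
      qed
    next
      case False
      from auction_skip [OF inv y this] show ?thesis
        using False y lt n
        by (cases "0 < s ''P'' (s ''R'' (s ''x'' 0) + s ''y'' 0)";
            cases "0 < s ''P'' (s ''R'' (s ''y'' 0) + s ''x'' 0)") (simp_all add: auction_round_def)
    qed
  next
    case False
    then have y: "s ''y'' 0 = n"
      using x by simp
    note inv' = inv [unfolded y]
    show ?thesis
    proof (cases "s ''l'' (s ''x'' 0) < n")
      case True
      from auction_raise [OF inv' i True] show ?thesis
        using y True n by (simp add: auction_round_def)
    next
      case False
      then have l: "s ''l'' (s ''x'' 0) = n"
        using x by simp
      from auction_drop [OF inv' i l] show ?thesis
        using y l n by (simp add: auction_round_def)
    qed
  qed
qed

lemma auction_potential_init: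
  "Suc (auction_potential 0 0 (\<lambda>_. 0) (\<lambda>_. 0)) \<le> 3 * Suc n ^ 3"
  by (simp add: auction_potential_def algebra_simps power3_eq_cube)

lemma runs_chains:
  assumes "s ''n'' 0 = n"
    and "\<And>u v. u < n \<Longrightarrow> v < n \<Longrightarrow> 0 < s ''P'' (s ''R'' u + v) \<longleftrightarrow> le u v"
    and "s ''i'' 0 = 0" "s ''x'' 0 = 0" "s ''y'' 0 = 0"
    and "s ''M'' = (\<lambda>_. 0)" "s ''U'' = (\<lambda>_. 0)" "s ''l'' = (\<lambda>_. 0)" "s ''p'' = (\<lambda>_. 0)"
  shows "runs chains s (600 * Suc n ^ 3)
    (\<lambda>s'. matching (s' ''M'') (s' ''U'') (s' ''l'') (s' ''p'') \<and>
          (\<forall>u<n. s' ''M'' u \<noteq> 0 \<or> s' ''l'' u = Suc n) \<and>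
          (\<forall>x. x \<notin> {''i'', ''x'', ''y'', ''z'', ''M'', ''U'', ''l'', ''p''} \<longrightarrow> s' x = s x))"
  unfolding chains_def
proof (rule runs_While_loop_free [where m = auction_measure and
      I = "\<lambda>s'. auction_state s' \<and> s' ''n'' = s ''n'' \<and> s' ''P'' = s ''P'' \<and> s' ''R'' = s ''R''"])
  have w: "writes auction_round = {''i'', ''x'', ''y'', ''z'', ''M'', ''U'', ''l'', ''p''}"
    by (auto simp: auction_round_def)
  show lf: "loop_free auction_round"
    by (simp add: auction_round_def)
  show "(auction_measure s + 1) * (1 + bcost (Less (Var ''i'') (Var ''n'')) + steps auction_round)
    \<le> 600 * Suc n ^ 3"
    using assms auction_potential_init by (simp add: auction_round_def)
  show "auction_state s \<and> s ''n'' = s ''n'' \<and> s ''P'' = s ''P'' \<and> s ''R'' = s ''R''"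
    using assms auction_init by simp
  show "(auction_state (effect auction_round s') \<and> effect auction_round s' ''n'' = s ''n'' \<and>
      effect auction_round s' ''P'' = s ''P'' \<and> effect auction_round s' ''R'' = s ''R'') \<and>
      auction_measure (effect auction_round s') < auction_measure s'"
    if "auction_state s' \<and> s' ''n'' = s ''n'' \<and> s' ''P'' = s ''P'' \<and> s' ''R'' = s ''R''"
      and "bval (Less (Var ''i'') (Var ''n'')) s'" for s'
    using auction_round_correct [of s'] that assms(1,2) effect_frame [OF lf, unfolded w] by simp
  show "matching (s' ''M'') (s' ''U'') (s' ''l'') (s' ''p'') \<and>
      (\<forall>u<n. s' ''M'' u \<noteq> 0 \<or> s' ''l'' u = Suc n) \<and>
      (\<forall>x. x \<notin> {''i'', ''x'', ''y'', ''z'', ''M'', ''U'', ''l'', ''p''} \<longrightarrow> s' x = s x)"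
    if "auction_state s' \<and> s' ''n'' = s ''n'' \<and> s' ''P'' = s ''P'' \<and> s' ''R'' = s ''R''"
      and "\<not> bval (Less (Var ''i'') (Var ''n'')) s'"
      and "\<And>x. x \<notin> writes auction_round \<Longrightarrow> s' x = s x" for s'
    using that auction_done assms(1) unfolding w by auto
qed

end

section \<open>Collecting the bottoms of the chains\<close>

definition bottoms :: com where
  "bottoms =
     ''i'' ::= Const 0 ;;
     While (Less (Var ''i'') (Var ''n''))
       (Cond (pos (Cell ''U'' (Var ''i''))) Skip
          (Assign ''B'' (Var ''c'') (Var ''i'') ;; incr ''c'') ;;
        incr ''i'')"

text \<open>The cardinality clause lets the width bound \<open>c\<close>; the zeros from
  \<open>c\<close> on are the default starts for surplus digits.\<close>

definition collected :: "(nat \<Rightarrow> nat) \<Rightarrow> nat \<Rightarrow> nat \<Rightarrow> (nat \<Rightarrow> nat) \<Rightarrow> bool" where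
  "collected U i c B \<longleftrightarrow> {v. v < i \<and> U v = 0} = B ` {..<c} \<and>
     card {v. v < i \<and> U v = 0} = c \<and> (\<forall>j\<ge>c. B j = 0)"

lemma collected_Suc:
  assumes "collected U i c B"
  shows "U i = 0 \<Longrightarrow> collected U (Suc i) (Suc c) (B(c := i))"
    and "0 < U i \<Longrightarrow> collected U (Suc i) c B"
proof -
  let ?F = "\<lambda>i. {v. v < i \<and> U v = 0}"
  note * = assms [unfolded collected_def]
  note F = conjunct1 [OF *] and c = conjunct1 [OF conjunct2 [OF *]]
    and B = conjunct2 [OF conjunct2 [OF *]]
  {
    assume "U i = 0"
    then have "?F (Suc i) = insert i (?F i)"
      by (auto simp: less_Suc_eq)
    moreover have "(B(c := i)) ` {..<Suc c} = insert i (B ` {..<c})"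
      by (auto simp: lessThan_Suc)
    moreover have "card (insert i (?F i)) = Suc c"
      using c by simp
    ultimately show "collected U (Suc i) (Suc c) (B(c := i))"
      unfolding collected_def using F B by simp
  }
  assume "0 < U i"
  then have "?F (Suc i) = ?F i"
    by (auto simp: less_Suc_eq)
  with F c B show "collected U (Suc i) c B"
    unfolding collected_def by metis
qed

lemma runs_bottoms:
  assumes "s ''n'' 0 = n" and "s ''c'' 0 = 0" and "s ''B'' = (\<lambda>_. 0)"
  shows "runs bottoms s (60 * Suc n)
    (\<lambda>s'. collected (s ''U'') n (s' ''c'' 0) (s' ''B'') \<and>
          (\<forall>x. x \<notin> {''i'', ''B'', ''c''} \<longrightarrow> s' x = s x))"
  unfolding bottoms_def
proof (rule runs_weaken [OF runs_prefix], simp)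
  let ?c = "Cond (pos (Cell ''U'' (Var ''i''))) Skip
          (Assign ''B'' (Var ''c'') (Var ''i'') ;; incr ''c'') ;; incr ''i''"
  let ?I = "\<lambda>s'. s' ''i'' 0 \<le> n \<and> s' ''n'' 0 = n \<and> s' ''U'' = s ''U'' \<and>
     collected (s ''U'') (s' ''i'' 0) (s' ''c'' 0) (s' ''B'')"
  let ?s = "effect (''i'' ::= Const 0) s"
  show "runs (While (Less (Var ''i'') (Var ''n'')) ?c) ?s (50 * Suc n)
    (\<lambda>s'. collected (s ''U'') n (s' ''c'' 0) (s' ''B'') \<and>
          (\<forall>x. x \<notin> {''i'', ''B'', ''c''} \<longrightarrow> s' x = s x))"
  proof (rule runs_While_loop_free [where I = ?I and m = "\<lambda>s'. n - s' ''i'' 0"])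
    show "?I ?s"
      using assms by (simp add: collected_def)
    show "?I (effect ?c s') \<and> n - effect ?c s' ''i'' 0 < n - s' ''i'' 0"
      if "?I s'" "bval (Less (Var ''i'') (Var ''n'')) s'" for s'
    proof -
      have I: "collected (s ''U'') (s' ''i'' 0) (s' ''c'' 0) (s' ''B'')" "s' ''U'' = s ''U''"
        using that by simp_all
      show ?thesis
        using that collected_Suc [OF I(1)] I(2)
        by (cases "s ''U'' (s' ''i'' 0) = 0") simp_all
    qed
    show "collected (s ''U'') n (s' ''c'' 0) (s' ''B'') \<and>
          (\<forall>x. x \<notin> {''i'', ''B'', ''c''} \<longrightarrow> s' x = s x)"
      if "?I s'" "\<not> bval (Less (Var ''i'') (Var ''n'')) s'" "\<And>x. x \<notin> writes ?c \<Longrightarrow> s' x = ?s x" for s'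
    proof -
      have "s' ''i'' 0 = n"
        using that(1,2) by simp
      with that(1,3) show ?thesis
        by simp
    qed
  qed (use assms(1) in simp_all)
qed simp_all

text \<open>\<open>z\<close> is 0 for a pair in order and otherwise the successor of the blocked
  index: \<open>j\<close> if \<open>q i j\<close> holds but the positions are not ordered,
  \<open>i\<close> in the opposite case.\<close>

definition scan_round :: com where
  "scan_round =
     ''z'' ::= Const 0 ;;
     Cond (Less (Var ''j'') (Var ''k''))
       (Cond (pos (Cell ''Q'' (Plus (Cell ''S'' (Var ''i'')) (Var ''j''))))
          (Cond (pos (Cell ''P'' (Plus (Cell ''R'' (Cell ''L'' (Var ''i''))) (Cell ''L'' (Var ''j'')))))
             Skip
             (''z'' ::= Plus (Var ''j'') (Const 1)))
          (Cond (pos (Cell ''P'' (Plus (Cell ''R'' (Cell ''L'' (Var ''i''))) (Cell ''L'' (Var ''j'')))))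
             (''z'' ::= Plus (Var ''i'') (Const 1))
             Skip) ;;
        Cond (pos (Var ''z''))
          (''z'' ::= Minus (Var ''z'') (Const 1) ;;
           Cond (pos (Cell ''M'' (Cell ''L'' (Var ''z''))))
             (Assign ''L'' (Var ''z'') (Minus (Cell ''M'' (Cell ''L'' (Var ''z''))) (Const 1)) ;;
              ''i'' ::= Const 0 ;;
              ''j'' ::= Const 0)
             (''h'' ::= Const 1))
          (incr ''j''))
       (incr ''i'' ;; ''j'' ::= Const 0)"

definition verdict :: "nat \<Rightarrow> com" where
  "verdict W =
     Cond (pos (Var ''h''))
       (''i'' ::= Const 0 ;;
        While (Conj (Less (Var ''i'') (Var ''k''))
                    (Neg (Less (Plus (Cell ''a'' (Var ''i'')) (Const 1)) (Const W))))
          (Assign ''a'' (Var ''i'') (Const 0) ;; incr ''i'') ;;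
        Cond (Less (Var ''i'') (Var ''k''))
          (Assign ''a'' (Var ''i'') (Plus (Cell ''a'' (Var ''i'')) (Const 1)))
          (''d'' ::= Const 1))
       (''out'' ::= Const 1 ;; ''d'' ::= Const 1)"

text \<open>
  The digits \<open>a\<close> of an odometer with base \<open>W\<close> select the bottoms in \<open>B\<close>. There may be fewer than
  \<open>W\<close> chains: the unused entries of \<open>B\<close> are 0, so that a larger digit selects the element 0.
\<close>
definition search_round :: "nat \<Rightarrow> com" where
  "search_round W =
     ''i'' ::= Const 0 ;;
     While (Less (Var ''i'') (Var ''k''))
       (Assign ''L'' (Var ''i'') (Cell ''B'' (Cell ''a'' (Var ''i''))) ;; incr ''i'') ;;
     (''i'' ::= Const 0 ;; ''j'' ::= Const 0 ;; ''h'' ::= Const 0) ;;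
     While (Conj (Neg (pos (Var ''h''))) (Less (Var ''i'') (Var ''k''))) scan_round ;;
     verdict W"

definition find_embedding :: "nat \<Rightarrow> com" where
  "find_embedding W = While (Neg (pos (Var ''d''))) (search_round W)"

text \<open>The arrays left by the chain phase are fixed parameters, since the search never writes
  to them.\<close>

locale search_setup = index_poset +
  fixes k :: nat and q :: "nat \<Rightarrow> nat \<Rightarrow> bool" and M U l p B :: "nat \<Rightarrow> nat" and W :: nat
  assumes q_refl: "i < k \<Longrightarrow> q i i"
    and matching: "matching M U l p"
    and complete: "v < n \<Longrightarrow> \<exists>j<W. follows M (B j) v"
    and B_bounded: "0 < n \<Longrightarrow> B j < n"
begin

text \<open>For \<open>n = 0\<close> all entries of the matrix are 0, so lookups at any index agree with \<open>le\<close>.\<close>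
definition ready :: "state \<Rightarrow> bool" where
  "ready s \<longleftrightarrow> s ''k'' 0 = k \<and> s ''M'' = M \<and> s ''B'' = B \<and>
     (\<forall>u v. (0 < n \<longrightarrow> u < n \<and> v < n) \<longrightarrow> (0 < s ''P'' (s ''R'' u + v) \<longleftrightarrow> le u v)) \<and>
     (\<forall>i<k. \<forall>j<k. 0 < s ''Q'' (s ''S'' i + j) \<longleftrightarrow> q i j)"

lemma ready_cong:
  assumes "ready s" and "\<And>x. x \<in> {''k'', ''M'', ''B'', ''P'', ''R'', ''Q'', ''S''} \<Longrightarrow> s' x = s x"
  shows "ready s'"
  using assms(1) by (simp add: ready_def assms(2))

abbreviation scan_state :: "(nat \<Rightarrow> nat) \<Rightarrow> state \<Rightarrow> bool" where
  "scan_state L0 s \<equiv> scan k q M L0 (s ''i'' 0) (s ''j'' 0) (s ''h'' 0) (s ''L'')"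

text \<open>The summand \<open>1 - h\<close> pays for the failing round, which sets \<open>h\<close>
  and leaves \<open>scan_potential\<close> unchanged.\<close>

abbreviation scan_measure :: "state \<Rightarrow> nat" where
  "scan_measure s \<equiv> (1 - s ''h'' 0) + scan_potential k (s ''i'' 0) (s ''j'' 0) (s ''L'')"

lemma blocked_cases:
  assumes "i < k" "j < k"
  shows "q i j \<Longrightarrow> \<not> le (L i) (L j) \<Longrightarrow> blocked k q L j"
    and "\<not> q i j \<Longrightarrow> le (L i) (L j) \<Longrightarrow> blocked k q L i"
  using assms unfolding blocked_def by blast+

text \<open>The load loop determines \<open>L\<close> only below \<open>k\<close>, so only there
  does it agree with the intended bottoms.\<close>

lemma scan_start_cong:
  assumes "\<And>i. i < k \<Longrightarrow> L0 i = L0' i"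
  shows "scan k q M L0 i j h L \<longleftrightarrow> scan k q M L0' i j h L"
  using assms by (simp add: scan_def)

lemma scan_round_correct:
  assumes r: "ready s" and inv: "scan_state L0 s" and h: "s ''h'' 0 = 0" and i: "s ''i'' 0 < k"
  shows "scan_state L0 (effect scan_round s) \<and> scan_measure (effect scan_round s) < scan_measure s"
proof -
  have k: "s ''k'' 0 = k" and M: "s ''M'' = M"
    using r by (simp_all add: ready_def)
  note inv = inv [unfolded h]
  show ?thesis
  proof (cases "s ''j'' 0 < k")
    case False
    from scan_row [OF inv i False] show ?thesis
      using False i k h by (simp add: scan_round_def)
  next
    case j: True
    let ?i = "s ''i'' 0" and ?j = "s ''j'' 0" and ?L = "s ''L''"
    have "0 < n \<longrightarrow> ?L ?i < n \<and> ?L ?j < n"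
      using inv i j unfolding scan_def by blast
    then have le: "0 < s ''P'' (s ''R'' (?L ?i) + ?L ?j) \<longleftrightarrow> le (?L ?i) (?L ?j)"
      using r unfolding ready_def by blast
    have q: "0 < s ''Q'' (s ''S'' ?i + ?j) \<longleftrightarrow> q ?i ?j"
      using r i j unfolding ready_def by blast
    show ?thesis
    proof (cases "q ?i ?j \<longleftrightarrow> le (?L ?i) (?L ?j)")
      case True
      from scan_step [OF inv i j True] show ?thesis
        using True i j k h le q
        by (cases "q ?i ?j") (simp_all add: scan_round_def)
    next
      case False
      define v where "v = (if q ?i ?j then ?j else ?i)"
      have b: "blocked k q ?L v"
        using False blocked_cases [OF i j, of ?L] by (auto simp: v_def)
      show ?thesis
      proof (cases "M (?L v)")
        case 0
        from scan_fail [OF matching inv b 0] show ?thesis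
          using False 0 i j k h le q M
          by (cases "q ?i ?j") (simp_all add: scan_round_def v_def)
      next
        case (Suc w)
        from scan_advance [OF matching inv b Suc] show ?thesis
          using False Suc i j k h le q M
          by (cases "q ?i ?j") (simp_all add: scan_round_def v_def)
      qed
    qed
  qed
qed

lemma scan_potential_init: "Suc (Suc (scan_potential k 0 0 L)) \<le> 2 * (Suc n * Suc k ^ 3)"
proof -
  have "(\<Sum>i<k. above (L i)) \<le> k * n"
    using sum_bounded_above [of "{..<k}" "\<lambda>i. above (L i)" n] above_le by simp
  then have "(\<Sum>i<k. above (L i)) * (Suc k * Suc k) \<le> (k * n) * (Suc k * Suc k)"
    by (rule mult_le_mono1)
  then show ?thesis
    unfolding scan_potential_def by (simp add: power3_eq_cube algebra_simps)
qed

lemma writes_scan_round: "writes scan_round = {''i'', ''j'', ''z'', ''h'', ''L''}"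
  by (auto simp: scan_round_def)

lemma loop_free_scan_round: "loop_free scan_round"
  by (simp add: scan_round_def)

lemma runs_scan:
  assumes "ready s" and "s ''i'' 0 = 0" "s ''j'' 0 = 0" "s ''h'' 0 = 0"
    and "0 < n \<Longrightarrow> \<forall>i<k. s ''L'' i < n"
  shows "runs (While (Conj (Neg (pos (Var ''h''))) (Less (Var ''i'') (Var ''k''))) scan_round) s
    (300 * (Suc n * Suc k ^ 3))
    (\<lambda>s'. scan_state (s ''L'') s' \<and> \<not> (s' ''h'' 0 = 0 \<and> s' ''i'' 0 < k) \<and>
       (\<forall>x. x \<notin> {''i'', ''j'', ''z'', ''h'', ''L''} \<longrightarrow> s' x = s x))"
proof (rule runs_While_loop_free [where m = scan_measure and
      I = "\<lambda>s'. ready s' \<and> scan_state (s ''L'') s'"])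
  show "loop_free scan_round"
    by (rule loop_free_scan_round)
  show "ready s \<and> scan_state (s ''L'') s"
    using assms scan_init by simp
  show "(scan_measure s + 1) * (1 + bcost (Conj (Neg (pos (Var ''h''))) (Less (Var ''i'') (Var ''k'')))
      + steps scan_round) \<le> 300 * (Suc n * Suc k ^ 3)"
    using scan_potential_init [of "s ''L''"] assms(2,3,4) by (simp add: scan_round_def)
  show "(ready (effect scan_round s') \<and> scan_state (s ''L'') (effect scan_round s')) \<and>
      scan_measure (effect scan_round s') < scan_measure s'"
    if s': "ready s' \<and> scan_state (s ''L'') s'"
      and b: "bval (Conj (Neg (pos (Var ''h''))) (Less (Var ''i'') (Var ''k''))) s'" for s'
  proof -
    have "ready (effect scan_round s')"
      by (rule ready_cong [of s'], simp add: s',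
          rule effect_frame [OF loop_free_scan_round], auto simp: writes_scan_round)
    moreover have "s' ''k'' 0 = k"
      using s' by (simp add: ready_def)
    ultimately show ?thesis
      using scan_round_correct [of s' "s ''L''"] s' b by simp
  qed
  show "scan_state (s ''L'') s' \<and> \<not> (s' ''h'' 0 = 0 \<and> s' ''i'' 0 < k) \<and>
       (\<forall>x. x \<notin> {''i'', ''j'', ''z'', ''h'', ''L''} \<longrightarrow> s' x = s x)"
    if "ready s' \<and> scan_state (s ''L'') s'"
      and "\<not> bval (Conj (Neg (pos (Var ''h''))) (Less (Var ''i'') (Var ''k''))) s'"
      and "\<And>x. x \<notin> writes scan_round \<Longrightarrow> s' x = s x" for s'
  proof -
    have "s' ''k'' 0 = k"
      using that(1) by (simp add: ready_def)
    with that(1,2) that(3) [unfolded writes_scan_round] show ?thesis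
      by simp
  qed
qed

end

section \<open>Loading start positions and incrementing the odometer\<close>

lemma runs_load:
  assumes "s ''k'' 0 = k" and "s ''i'' 0 = 0"
  shows "runs (While (Less (Var ''i'') (Var ''k''))
       (Assign ''L'' (Var ''i'') (Cell ''B'' (Cell ''a'' (Var ''i''))) ;; incr ''i'')) s (50 * Suc k)
    (\<lambda>s'. (\<forall>i<k. s' ''L'' i = s ''B'' (s ''a'' i)) \<and> (\<forall>x. x \<notin> {''i'', ''L''} \<longrightarrow> s' x = s x))"
  by (rule runs_While_loop_free [where m = "\<lambda>s'. k - s' ''i'' 0" and
      I = "\<lambda>s'. s' ''k'' 0 = k \<and> s' ''i'' 0 \<le> k \<and> s' ''B'' = s ''B'' \<and> s' ''a'' = s ''a'' \<and>
        (\<forall>i<s' ''i'' 0. s' ''L'' i = s ''B'' (s ''a'' i))"])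
    (use assms in \<open>simp_all add: less_Suc_eq\<close>)

lemma runs_carry:
  assumes "s ''k'' 0 = k" and "s ''i'' 0 = 0" and "\<forall>i<k. s ''a'' i < W"
  shows "runs (While (Conj (Less (Var ''i'') (Var ''k''))
        (Neg (Less (Plus (Cell ''a'' (Var ''i'')) (Const 1)) (Const W))))
       (Assign ''a'' (Var ''i'') (Const 0) ;; incr ''i'')) s (50 * Suc k)
    (\<lambda>s'. carry W k (s ''a'') (s' ''i'' 0) (s' ''a'') \<and>
       (s' ''i'' 0 < k \<longrightarrow> Suc (s' ''a'' (s' ''i'' 0)) < W) \<and>
       (\<forall>x. x \<notin> {''i'', ''a''} \<longrightarrow> s' x = s x))"
proof (rule runs_While_loop_free [where m = "\<lambda>s'. k - s' ''i'' 0" and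
      I = "\<lambda>s'. s' ''k'' 0 = k \<and> carry W k (s ''a'') (s' ''i'' 0) (s' ''a'')"])
  let ?c = "Assign ''a'' (Var ''i'') (Const 0) ;; incr ''i''"
  show "(effect ?c s' ''k'' 0 = k \<and> carry W k (s ''a'') (effect ?c s' ''i'' 0) (effect ?c s' ''a'')) \<and>
      k - effect ?c s' ''i'' 0 < k - s' ''i'' 0"
    if "s' ''k'' 0 = k \<and> carry W k (s ''a'') (s' ''i'' 0) (s' ''a'')"
      and "bval (Conj (Less (Var ''i'') (Var ''k''))
        (Neg (Less (Plus (Cell ''a'' (Var ''i'')) (Const 1)) (Const W)))) s'" for s'
    using that carry_step [of W k "s ''a''" "s' ''i'' 0" "s' ''a''"] by (simp add: diff_less_mono2)
qed (use assms in \<open>simp_all add: carry_def\<close>)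

context search_setup
begin

abbreviation search_state :: "state \<Rightarrow> bool" where
  "search_state s \<equiv> ready s \<and> search k q M B W (s ''a'') (s ''d'' 0) (s ''out'' 0)"

text \<open>Counts the assignments still open, the current one included; under
  \<open>search_state\<close> it is positive until \<open>d\<close> is set.\<close>

abbreviation search_measure :: "state \<Rightarrow> nat" where
  "search_measure s \<equiv> if s ''d'' 0 = 0 then W ^ k - radix_value W k (s ''a'') else 0"

lemma runs_search_round:
  assumes s: "search_state s" and d: "s ''d'' 0 = 0"
  shows "runs (search_round W) s (600 * (Suc n * Suc k ^ 3))
    (\<lambda>s'. search_state s' \<and> search_measure s' < search_measure s)"
proof -
  have k: "s ''k'' 0 = k" and B: "s ''B'' = B"
    using s by (simp_all add: ready_def)
  have S: "search k q M B W (s ''a'') 0 (s ''out'' 0)"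
    using s d by simp
  then have a: "\<forall>i<k. s ''a'' i < W"
    by (simp add: search_def)
  then have less: "radix_value W k (s ''a'') < W ^ k"
    by (intro radix_value_less) simp
  have frame: "ready s'" if "\<And>x. x \<notin> {''i'', ''j'', ''z'', ''h'', ''L'', ''a'', ''d'', ''out''} \<Longrightarrow> s' x = s x" for s'
    by (rule ready_cong [of s], simp add: s, rule that, auto)
  define L0 where "L0 = (\<lambda>i. B (s ''a'' i))"
  define same where "same s' \<longleftrightarrow>
    (\<forall>x. x \<notin> {''i'', ''j'', ''z'', ''h'', ''L''} \<longrightarrow> s' x = s x)" for s'
  \<comment> \<open>Covers every state in which the scan can stop; \<open>same\<close> records that
    only scratch arrays differ from \<open>s\<close>.\<close>
  have decide: "runs
      (verdict W) s' (150 * Suc k)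
      (\<lambda>s'. search_state s' \<and> search_measure s' < search_measure s)"
    if scan: "scan k q M L0 (s' ''i'' 0) (s' ''j'' 0) (s' ''h'' 0) (s' ''L'')"
      and fin: "\<not> (s' ''h'' 0 = 0 \<and> s' ''i'' 0 < k)"
      and same: "same s'" for s'
  proof -
    let ?inc = "Assign ''a'' (Var ''i'') (Plus (Cell ''a'' (Var ''i'')) (Const 1))"
    let ?R = "\<lambda>s'. search_state s' \<and> search_measure s' < search_measure s"
    have reject: "runs (''i'' ::= Const 0 ;;
        While (Conj (Less (Var ''i'') (Var ''k''))
                    (Neg (Less (Plus (Cell ''a'' (Var ''i'')) (Const 1)) (Const W))))
          (Assign ''a'' (Var ''i'') (Const 0) ;; incr ''i'') ;;
        Cond (Less (Var ''i'') (Var ''k'')) ?inc (''d'' ::= Const 1)) s' (80 * Suc k) ?R"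
      if "s' ''h'' 0 \<noteq> 0"
    proof -
      have no: "\<not> (\<exists>e. index_embedding k q e \<and> (\<forall>i<k. follows M (B (s ''a'' i)) (e i)))"
        using scan_reject [OF scan that] by (simp add: L0_def)
      let ?s = "effect (''i'' ::= Const 0) s'"
      have pre: "?s ''k'' 0 = k" "?s ''i'' 0 = 0" "\<forall>i<k. ?s ''a'' i < W" "?s ''a'' = s ''a''"
        using same a k by (simp_all add: same_def)
      show ?thesis
      proof (rule runs_weaken [OF runs_prefix [OF _ runs_Seq [OF runs_carry [OF pre(1-3)]]]])
        fix t
        assume *: "carry W k (?s ''a'') (t ''i'' 0) (t ''a'') \<and>
          (t ''i'' 0 < k \<longrightarrow> Suc (t ''a'' (t ''i'' 0)) < W) \<and>
          (\<forall>x. x \<notin> {''i'', ''a''} \<longrightarrow> t x = ?s x)"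
        then have c: "carry W k (s ''a'') (t ''i'' 0) (t ''a'')"
          and digits: "\<forall>i<k. t ''a'' i < W"
          unfolding pre(4) by (simp_all add: carry_def)
        have t: "t x = s x" if "x \<notin> {''i'', ''j'', ''z'', ''h'', ''L'', ''a''}" for x
          using * same that by (simp add: same_def)
        show "runs (Cond (Less (Var ''i'') (Var ''k'')) ?inc (''d'' ::= Const 1)) t
          (steps (Cond (Less (Var ''i'') (Var ''k'')) ?inc (''d'' ::= Const 1))) ?R"
        proof (rule runs_loop_free)
          show "?R (effect (Cond (Less (Var ''i'') (Var ''k'')) ?inc (''d'' ::= Const 1)) t)"
          proof (cases "t ''i'' 0 < k")
            case True
            let ?a = "(t ''a'')(t ''i'' 0 := Suc (t ''a'' (t ''i'' 0)))"
            have r: "radix_value W k ?a = Suc (radix_value W k (s ''a''))"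
              using carry_increment [OF c True] * True by blast
            have "ready (effect ?inc t)"
              by (rule frame) (simp add: t)
            moreover have "search k q M B W ?a 0 (s ''out'' 0)"
              by (rule search_next [OF S no _ r]) (use * True digits in simp)
            ultimately show ?thesis
              using True r less by (simp add: t k d)
          next
            case False
            have "ready (effect (''d'' ::= Const 1) t)"
              by (rule frame) (simp add: t)
            moreover have "search k q M B W (t ''a'') 1 (s ''out'' 0)"
              by (rule search_finish [OF S no digits carry_overflow [OF c False] complete])
            ultimately show ?thesis
              using False less by (simp add: t k d)
          qed
        qed simp
      qed simp_all
    qed
    have accept: "runs (''out'' ::= Const 1 ;; ''d'' ::= Const 1) s' (80 * Suc k) ?R"
      if "s' ''h'' 0 = 0"
    proof (rule runs_weaken [OF runs_loop_free [where R = ?R]])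
      have "ready (effect (''out'' ::= Const 1 ;; ''d'' ::= Const 1) s')"
        by (rule frame) (use same in \<open>simp add: same_def\<close>)
      moreover have "index_embedding k q (s' ''L'')"
        by (rule scan_accept [OF scan [unfolded that]]) (use fin that q_refl in auto)
      then have "search k q M B W (s ''a'') 1 1"
        by (rule search_accept [OF S])
      ultimately show "?R (effect (''out'' ::= Const 1 ;; ''d'' ::= Const 1) s')"
        using same less d by (simp add: same_def)
    qed simp_all
    show ?thesis
      unfolding verdict_def
    proof (rule runs_weaken [OF runs_Cond [where T = "80 * Suc k"]])
      show "1 + bcost (pos (Var ''h'')) + 80 * Suc k \<le> 150 * Suc k"
        by simp
    qed (use reject accept in simp_all)
  qed
  let ?s1 = "effect (''i'' ::= Const 0) s"
  show ?thesis
    unfolding search_round_def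
  proof (rule runs_weaken [OF runs_prefix [OF _ runs_Seq [OF runs_load [of ?s1 k]]]])
    fix s2
    assume load: "(\<forall>i<k. s2 ''L'' i = ?s1 ''B'' (?s1 ''a'' i)) \<and>
      (\<forall>x. x \<notin> {''i'', ''L''} \<longrightarrow> s2 x = ?s1 x)"
    have s2: "s2 x = s x" if "x \<notin> {''i'', ''L''}" for x
    proof -
      have "s2 x = ?s1 x"
        by (rule load [THEN conjunct2, rule_format, OF that])
      then show ?thesis
        using that by simp
    qed
    let ?init = "''i'' ::= Const 0 ;; ''j'' ::= Const 0 ;; ''h'' ::= Const 0"
    let ?s3 = "effect ?init s2"
    have L: "?s3 ''L'' i = L0 i" if "i < k" for i
    proof -
      have "s2 ''L'' i = ?s1 ''B'' (?s1 ''a'' i)"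
        by (rule load [THEN conjunct1, rule_format, OF that])
      then show ?thesis
        by (simp add: L0_def B)
    qed
    have ready: "ready ?s3"
      by (rule frame) (simp add: s2)
    show "runs (?init ;; While (Conj (Neg (pos (Var ''h''))) (Less (Var ''i'') (Var ''k''))) scan_round ;;
      verdict W) s2
      (steps ?init + (300 * (Suc n * Suc k ^ 3) + 150 * Suc k))
      (\<lambda>s'. search_state s' \<and> search_measure s' < search_measure s)"
    proof (rule runs_prefix [OF _ runs_Seq [OF runs_scan [OF ready]]])
      fix t
      assume t: "scan_state (?s3 ''L'') t \<and> \<not> (t ''h'' 0 = 0 \<and> t ''i'' 0 < k) \<and>
         (\<forall>x. x \<notin> {''i'', ''j'', ''z'', ''h'', ''L''} \<longrightarrow> t x = ?s3 x)"
      have "scan k q M L0 (t ''i'' 0) (t ''j'' 0) (t ''h'' 0) (t ''L'')"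
        using t [THEN conjunct1] by (rule scan_start_cong [THEN iffD1, rotated]) (rule L)
      moreover have "\<not> (t ''h'' 0 = 0 \<and> t ''i'' 0 < k)"
        by (rule t [THEN conjunct2, THEN conjunct1])
      moreover have "same t"
        unfolding same_def
      proof (intro allI impI)
        fix x
        assume x: "x \<notin> {''i'', ''j'', ''z'', ''h'', ''L''}"
        have "t x = ?s3 x"
          by (rule t [THEN conjunct2, THEN conjunct2, rule_format, OF x])
        then show "t x = s x"
          using x s2 [of x] by simp
      qed
      ultimately show "runs (verdict W) t (150 * Suc k)
          (\<lambda>s'. search_state s' \<and> search_measure s' < search_measure s)"
        by (rule decide)
    qed (use L B_bounded in \<open>simp_all add: L0_def\<close>)
  next
    \<comment> \<open>Linear in \<open>m\<close> and \<open>m'\<close>, which stand for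
      \<open>Suc k\<close> and the product \<open>Suc n * Suc k ^ 3\<close>.\<close>
    have bound: "steps (''i'' ::= Const 0) + (50 * m +
        (steps (''i'' ::= Const 0 ;; ''j'' ::= Const 0 ;; ''h'' ::= Const 0) +
         (300 * m' + 150 * m))) \<le> 600 * m'" if "1 \<le> m" "m \<le> m'" for m m' :: nat
      using that by simp
    have "Suc k \<le> Suc k ^ 3"
      by (rule self_le_power) simp_all
    then have "1 * Suc k \<le> Suc n * Suc k ^ 3"
      by (intro mult_le_mono) simp
    then have *: "Suc k \<le> Suc n * Suc k ^ 3"
      by (simp only: mult_1)
    show "steps (''i'' ::= Const 0) + (50 * Suc k +
        (steps (''i'' ::= Const 0 ;; ''j'' ::= Const 0 ;; ''h'' ::= Const 0) +
         (300 * (Suc n * Suc k ^ 3) + 150 * Suc k))) \<le> 600 * (Suc n * Suc k ^ 3)"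
      by (rule bound [OF _ *]) simp
  qed (use k in simp_all)
qed

text \<open>Each of the at most \<open>W ^ k\<close> rounds rules out one assignment or ends the
  search; \<open>Suc\<close> pays for the last test.\<close>

lemma runs_find_embedding:
  assumes "search_state s" and "s ''d'' 0 = 0"
  shows "runs (find_embedding W) s (700 * (Suc n * Suc k ^ 3) * Suc (W ^ k))
    (\<lambda>s'. s' ''out'' 0 = 1 \<longleftrightarrow> (\<exists>e. index_embedding k q e))"
  unfolding find_embedding_def
proof (rule runs_weaken [OF runs_While [where I = search_state and m = search_measure]])
  show "search_state s"
    by (rule assms(1))
  show "runs (search_round W) s' (600 * (Suc n * Suc k ^ 3))
      (\<lambda>s''. search_state s'' \<and> search_measure s'' < search_measure s')"
    if "search_state s'" "bval (Neg (pos (Var ''d''))) s'" for s'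
    using that by (intro runs_search_round) auto
  have "1 + bcost (Neg (pos (Var ''d''))) + 600 * m \<le> 700 * m" if "1 \<le> m" for m
    using that by simp
  moreover have "1 \<le> Suc n * Suc k ^ 3"
    by (simp add: Suc_le_eq)
  moreover have "search_measure s + 1 \<le> Suc (W ^ k)"
    by simp
  ultimately have "(search_measure s + 1) * (1 + bcost (Neg (pos (Var ''d''))) + 600 * (Suc n * Suc k ^ 3))
      \<le> Suc (W ^ k) * (700 * (Suc n * Suc k ^ 3))"
    by (intro mult_le_mono) blast+
  then show "(search_measure s + 1) * (1 + bcost (Neg (pos (Var ''d''))) + 600 * (Suc n * Suc k ^ 3))
      \<le> 700 * (Suc n * Suc k ^ 3) * Suc (W ^ k)"
    by (simp only: mult.commute)
  show "s' ''out'' 0 = 1 \<longleftrightarrow> (\<exists>e. index_embedding k q e)"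
    if "search_state s' \<and> \<not> bval (Neg (pos (Var ''d''))) s'" for s'
    using that by (simp add: search_def)
qed

end

section \<open>Correctness of the algorithm\<close>

text \<open>\<open>W\<close> is compiled into the program: the algorithm depends on the class only
  through its width bound.\<close>

definition embedding_program :: "nat \<Rightarrow> com" where
  "embedding_program W =
     row_offsets ''R'' ''n'' ;; row_offsets ''S'' ''k'' ;;
     ''i'' ::= Const 0 ;; chains ;; bottoms ;; find_embedding W"

section \<open>Posets as relations on indices\<close>

definition index_rel :: "'a poset \<Rightarrow> 'a list \<Rightarrow> nat \<Rightarrow> nat \<Rightarrow> bool" where
  "index_rel P xs u v \<longleftrightarrow> u < length xs \<and> v < length xs \<and> (xs ! u, xs ! v) \<in> snd P"

lemma order_matrix_pos:
  assumes "0 < length xs \<longrightarrow> u < length xs \<and> v < length xs"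
  shows "0 < order_matrix P xs (u * length xs + v) \<longleftrightarrow> index_rel P xs u v"
proof (cases "length xs = 0")
  case True
  then show ?thesis
    by (simp add: order_matrix_def index_rel_def)
next
  case False
  then have uv: "u < length xs" "v < length xs"
    using assms by simp_all
  have "u * length xs + v < Suc u * length xs"
    using uv by simp
  also have "\<dots> \<le> length xs * length xs"
    using uv by (intro mult_le_mono1) simp
  finally have "u * length xs + v < length xs * length xs" .
  moreover have "(u * length xs + v) div length xs = u"
    using div_mult_self3 [of "length xs" u v] False uv by simp
  ultimately show ?thesis
    using uv by (simp add: order_matrix_def index_rel_def Let_def)
qed

lemma finite_poset_refl: "finite_poset P \<Longrightarrow> x \<in> fst P \<Longrightarrow> (x, x) \<in> snd P"
  unfolding finite_poset_def partial_order_on_def preorder_on_def refl_on_def by blast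

lemma finite_poset_antisym:
  "finite_poset P \<Longrightarrow> (x, y) \<in> snd P \<Longrightarrow> (y, x) \<in> snd P \<Longrightarrow> x = y"
  unfolding finite_poset_def partial_order_on_def antisym_def by blast

lemma finite_poset_trans:
  "finite_poset P \<Longrightarrow> (x, y) \<in> snd P \<Longrightarrow> (y, z) \<in> snd P \<Longrightarrow> (x, z) \<in> snd P"
  unfolding finite_poset_def partial_order_on_def preorder_on_def trans_def by blast

lemma index_poset_index_rel:
  assumes "finite_poset P" and "enumerates xs P"
  shows "index_poset (length xs) (index_rel P xs)"
proof
  have xs: "distinct xs" "set xs = fst P"
    using assms(2) by (simp_all add: enumerates_def)
  fix u v x
  show "index_rel P xs u v \<Longrightarrow> u < length xs \<and> v < length xs"
    by (simp add: index_rel_def)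
  show "u < length xs \<Longrightarrow> index_rel P xs u u"
    using finite_poset_refl [OF assms(1), of "xs ! u"] by (simp add: index_rel_def flip: xs(2))
  show "u = v" if "index_rel P xs u v" "index_rel P xs v u"
  proof -
    have uv: "u < length xs" "v < length xs" "(xs ! u, xs ! v) \<in> snd P" "(xs ! v, xs ! u) \<in> snd P"
      using that by (simp_all add: index_rel_def)
    then have "xs ! u = xs ! v"
      by (intro finite_poset_antisym [OF assms(1)])
    with uv(1,2) show "u = v"
      by (simp add: nth_eq_iff_index_eq [OF xs(1)])
  qed
  show "index_rel P xs u v \<Longrightarrow> index_rel P xs v x \<Longrightarrow> index_rel P xs u x"
    using finite_poset_trans [OF assms(1), of "xs ! u" "xs ! v" "xs ! x"] by (simp add: index_rel_def)
qed

lemma embeds_iff_index_embedding: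
  assumes P: "finite_poset P" "enumerates xs P" and Q: "finite_poset Q" "enumerates ys Q"
  shows "embeds Q P \<longleftrightarrow>
    (\<exists>e. index_poset.index_embedding (length xs) (index_rel P xs) (length ys) (index_rel Q ys) e)"
proof -
  interpret index_poset "length xs" "index_rel P xs"
    by (rule index_poset_index_rel [OF P])
  have xs: "distinct xs" "set xs = fst P" and ys: "distinct ys" "set ys = fst Q"
    using P(2) Q(2) by (simp_all add: enumerates_def)
  show ?thesis
  proof
    assume "embeds Q P"
    then obtain f where f: "embedding Q P f"
      by (auto simp: embeds_def)
    have "\<forall>i<length ys. \<exists>u<length xs. xs ! u = f (ys ! i)"
      using f xs(2) ys(2) unfolding embedding_def by (metis image_subset_iff in_set_conv_nth)
    then obtain e where e: "\<forall>i<length ys. e i < length xs \<and> xs ! e i = f (ys ! i)"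
      by metis
    have "index_rel Q ys i j \<longleftrightarrow> index_rel P xs (e i) (e j)" if "i < length ys" "j < length ys" for i j
      using f e that nth_mem [of _ ys] unfolding embedding_def index_rel_def ys(2) by simp
    with e have "index_embedding (length ys) (index_rel Q ys) e"
      by (simp add: index_embedding_def)
    then show "\<exists>e. index_embedding (length ys) (index_rel Q ys) e"
      by blast
  next
    assume "\<exists>e. index_embedding (length ys) (index_rel Q ys) e"
    then obtain e where e: "\<And>i. i < length ys \<Longrightarrow> e i < length xs"
      "\<And>i j. i < length ys \<Longrightarrow> j < length ys \<Longrightarrow> index_rel Q ys i j \<longleftrightarrow> index_rel P xs (e i) (e j)"
      unfolding index_embedding_def by blast
    have "\<forall>y\<in>fst Q. \<exists>i<length ys. ys ! i = y"
      using ys(2) by (metis in_set_conv_nth)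
    then obtain g where g: "\<And>y. y \<in> fst Q \<Longrightarrow> g y < length ys" "\<And>y. y \<in> fst Q \<Longrightarrow> ys ! g y = y"
      by metis
    let ?f = "\<lambda>y. xs ! e (g y)"
    have iff: "(y, z) \<in> snd Q \<longleftrightarrow> (?f y, ?f z) \<in> snd P" if "y \<in> fst Q" "z \<in> fst Q" for y z
      using e(2) [of "g y" "g z"] that g e(1) by (simp add: index_rel_def)
    have inP: "?f y \<in> fst P" if "y \<in> fst Q" for y
      using that g(1) e(1) xs(2) nth_mem by metis
    \<comment> \<open>Reflexivity of \<open>P\<close> makes equal images comparable both ways, and
      antisymmetry of \<open>Q\<close> then identifies the arguments.\<close>
    have "inj_on ?f (fst Q)"
    proof (rule inj_onI)
      fix y z
      assume yz: "y \<in> fst Q" "z \<in> fst Q" "?f y = ?f z"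
      then have "(?f y, ?f z) \<in> snd P" "(?f z, ?f y) \<in> snd P"
        using finite_poset_refl [OF P(1) inP] by simp_all
      then have "(y, z) \<in> snd Q" "(z, y) \<in> snd Q"
        using iff [of y z] iff [of z y] yz by simp_all
      then show "y = z"
        by (rule finite_poset_antisym [OF Q(1)])
    qed
    then have "embedding Q P ?f"
      using inP iff by (auto simp: embedding_def)
    then show "embeds Q P"
      by (auto simp: embeds_def)
  qed
qed

text \<open>Antisymmetry turns the absence of \<open>lt\<close> into incomparability of distinct
  elements; as there are finitely many antichains, the \<open>Max\<close> in \<open>width\<close> is
  an upper bound.\<close>

lemma index_antichain_le_width:
  assumes P: "finite_poset P" "enumerates xs P"
    and A: "A \<subseteq> {..<length xs}"
    and incomparable: "\<And>u v. u \<in> A \<Longrightarrow> v \<in> A \<Longrightarrow> \<not> index_poset.lt (index_rel P xs) u v"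
  shows "card A \<le> width P"
proof -
  interpret index_poset "length xs" "index_rel P xs"
    by (rule index_poset_index_rel [OF P])
  have xs: "distinct xs" "set xs = fst P"
    using P(2) by (simp_all add: enumerates_def)
  have "(xs ! u, xs ! v) \<notin> snd P" if "u \<in> A" "v \<in> A" "xs ! u \<noteq> xs ! v" for u v
  proof
    assume "(xs ! u, xs ! v) \<in> snd P"
    then have "index_rel P xs u v"
      using that A by (auto simp: index_rel_def)
    with incomparable [OF that(1,2)] le_antisym that(3) show False
      unfolding lt_def by blast
  qed
  then have "antichain P (nth xs ` A)"
    using A xs(2) by (fastforce simp: antichain_def pairwise_def)
  moreover have "finite {S. antichain P S}"
    by (rule finite_subset [of _ "Pow (fst P)"]) (use P(1) in \<open>auto simp: antichain_def finite_poset_def\<close>)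
  ultimately have "card (nth xs ` A) \<le> width P"
    unfolding width_def by (intro Max_ge) auto
  moreover have "inj_on (nth xs) A"
    using A nth_eq_iff_index_eq [OF xs(1)] by (intro inj_onI) (metis lessThan_iff subsetD)
  ultimately show ?thesis
    by (simp add: card_image)
qed

text \<open>Every element lies above a bottom, and the bottoms are the \<open>B j\<close> with
  \<open>j < c\<close>; entries from \<open>c\<close> on are 0, a valid index once
  \<open>0 < n\<close>.\<close>

lemma chains_complete:
  assumes "index_poset n le" and m: "index_poset.matching n le M U l p"
    and c: "collected U n c B" "c \<le> W"
  shows "v < n \<Longrightarrow> \<exists>j<W. (\<lambda>u v. M u = Suc v)\<^sup>*\<^sup>* (B j) v" and "0 < n \<Longrightarrow> B j < n"
proof -
  interpret index_poset n le by fact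
  have B: "{v. v < n \<and> U v = 0} = B ` {..<c}" "\<And>j. c \<le> j \<Longrightarrow> B j = 0"
    using c(1) by (simp_all add: collected_def)
  show "\<exists>j<W. (\<lambda>u v. M u = Suc v)\<^sup>*\<^sup>* (B j) v" if v: "v < n"
  proof -
    obtain u where u: "u < n" "U u = 0" "follows M u v"
      using matching_bottom [OF m v] by blast
    then have "u \<in> B ` {..<c}"
      using B(1) by blast
    with u(3) c(2) show ?thesis
      using less_le_trans by blast
  qed
  show "B j < n" if "0 < n"
    using that B by (cases "j < c") (blast, simp)
qed

text \<open>The strict bound on the width ensures \<open>0 < W\<close>, on which the all-zero
  initial digits and the estimate \<open>1 \<le> W ^ k\<close> rely.\<close>

lemma runs_embedding_program:
  fixes P :: "'a poset" and Q :: "'b poset"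
  assumes P: "finite_poset P" "enumerates xs P" and Q: "finite_poset Q" "enumerates ys Q"
    and w: "width P < W"
  defines "n \<equiv> length xs" and "k \<equiv> length ys"
  shows "runs (embedding_program W) (initial_state Q ys P xs)
    (3000 * (Suc k ^ 3 * W ^ k) * Suc n ^ 3) (\<lambda>s. accepting s \<longleftrightarrow> embeds Q P)"
proof -
  interpret index_poset n "index_rel P xs"
    unfolding n_def by (rule index_poset_index_rel [OF P])
  let ?s = "initial_state Q ys P xs"
  have input: "?s ''n'' 0 = n" "?s ''k'' 0 = k" "?s ''P'' = order_matrix P xs" "?s ''Q'' = order_matrix Q ys"
    by (simp_all add: initial_state_def n_def k_def)
  have zero: "?s x = (\<lambda>_. 0)" if "x \<notin> {''n'', ''k'', ''P'', ''Q''}" for x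
    using that by (simp add: initial_state_def)
  have "runs (embedding_program W) ?s
    (40 * (n + 1) + (40 * (k + 1) + (steps (''i'' ::= Const 0) + (600 * Suc n ^ 3 + (60 * Suc n +
      700 * (Suc n * Suc k ^ 3) * Suc (W ^ k))))))
    (\<lambda>s. accepting s \<longleftrightarrow> embeds Q P)"
    unfolding embedding_program_def
  proof (rule runs_Seq)
    show "runs (row_offsets ''R'' ''n'') ?s (40 * (n + 1)) (\<lambda>s1.
        (\<forall>u\<le>n. s1 ''R'' u = u * n) \<and> (\<forall>x. x \<notin> {''R'', ''i''} \<longrightarrow> s1 x = ?s x))"
      using runs_row_offsets [of ?s "''R''" "''n''"] by (simp add: input zero)
    fix s1
    assume *: "(\<forall>u\<le>n. s1 ''R'' u = u * n) \<and> (\<forall>x. x \<notin> {''R'', ''i''} \<longrightarrow> s1 x = ?s x)"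
    note R1 = * [THEN conjunct1, rule_format] and s1 = * [THEN conjunct2, rule_format]
    show "runs (row_offsets ''S'' ''k'' ;; ''i'' ::= Const 0 ;; chains ;; bottoms ;; find_embedding W) s1
      (40 * (k + 1) + (steps (''i'' ::= Const 0) + (600 * Suc n ^ 3 + (60 * Suc n +
        700 * (Suc n * Suc k ^ 3) * Suc (W ^ k))))) (\<lambda>s. accepting s \<longleftrightarrow> embeds Q P)"
    proof (rule runs_Seq)
      show "runs (row_offsets ''S'' ''k'') s1 (40 * (k + 1)) (\<lambda>s2.
          (\<forall>u\<le>k. s2 ''S'' u = u * k) \<and> (\<forall>x. x \<notin> {''S'', ''i''} \<longrightarrow> s2 x = s1 x))"
        using runs_row_offsets [of s1 "''S''" "''k''"] by (simp add: input zero s1)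
      fix s2
      assume *: "(\<forall>u\<le>k. s2 ''S'' u = u * k) \<and> (\<forall>x. x \<notin> {''S'', ''i''} \<longrightarrow> s2 x = s1 x)"
      note S2 = * [THEN conjunct1, rule_format] and s2 = * [THEN conjunct2, rule_format]
      let ?s3 = "effect (''i'' ::= Const 0) s2"
      have s3: "?s3 x = ?s x" if "x \<notin> {''R'', ''S'', ''i''}" for x
        using that s1 [of x] s2 [of x] by simp
      have R: "?s3 ''R'' u = u * n" if "u \<le> n" for u
        using R1 [OF that] s2 [of "''R''"] by simp
      have S: "?s3 ''S'' u = u * k" if "u \<le> k" for u
        using S2 [OF that] by simp
      have le: "0 < ?s3 ''P'' (?s3 ''R'' u + v) \<longleftrightarrow> index_rel P xs u v"
        if "0 < n \<longrightarrow> u < n \<and> v < n" for u v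
      proof (cases "n = 0")
        case True
        then show ?thesis
          using s3 [of "''P''"] input(3) by (simp add: order_matrix_def index_rel_def n_def)
      next
        case False
        then have "?s3 ''R'' u = u * length xs"
          using R [of u] that by (simp add: n_def)
        moreover have "?s3 ''P'' = order_matrix P xs"
          using s3 [of "''P''"] input(3) by simp
        ultimately show ?thesis
          using order_matrix_pos that unfolding n_def by metis
      qed
      have q: "0 < ?s3 ''Q'' (?s3 ''S'' i + j) \<longleftrightarrow> index_rel Q ys i j" if "i < k" "j < k" for i j
      proof -
        have "?s3 ''S'' i = i * length ys"
          using S [of i] that by (simp add: k_def)
        moreover have "?s3 ''Q'' = order_matrix Q ys"
          using s3 [of "''Q''"] input(4) by simp
        ultimately show ?thesis
          using order_matrix_pos that unfolding k_def by metis
      qed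
      have start: "?s3 ''n'' 0 = n" "?s3 ''i'' 0 = 0" "?s3 ''x'' 0 = 0" "?s3 ''y'' 0 = 0"
        "?s3 ''M'' = (\<lambda>_. 0)" "?s3 ''U'' = (\<lambda>_. 0)" "?s3 ''l'' = (\<lambda>_. 0)" "?s3 ''p'' = (\<lambda>_. 0)"
        using s3 input zero by simp_all
      show "runs (''i'' ::= Const 0 ;; chains ;; bottoms ;; find_embedding W) s2
        (steps (''i'' ::= Const 0) + (600 * Suc n ^ 3 + (60 * Suc n +
          700 * (Suc n * Suc k ^ 3) * Suc (W ^ k)))) (\<lambda>s. accepting s \<longleftrightarrow> embeds Q P)"
      proof (rule runs_prefix [OF _ runs_Seq [OF runs_chains [of ?s3]]])
        fix s4
        assume *: "matching (s4 ''M'') (s4 ''U'') (s4 ''l'') (s4 ''p'') \<and>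
          (\<forall>u<n. s4 ''M'' u \<noteq> 0 \<or> s4 ''l'' u = Suc n) \<and>
          (\<forall>x. x \<notin> {''i'', ''x'', ''y'', ''z'', ''M'', ''U'', ''l'', ''p''} \<longrightarrow> s4 x = ?s3 x)"
        note m = * [THEN conjunct1] and settled = * [THEN conjunct2, THEN conjunct1, rule_format]
          and s4 = * [THEN conjunct2, THEN conjunct2, rule_format]
        obtain A where A: "A \<subseteq> {..<n}" "\<And>u v. u \<in> A \<Longrightarrow> v \<in> A \<Longrightarrow> \<not> lt u v"
          "card {v. v < n \<and> s4 ''U'' v = 0} \<le> card A"
          using matching_antichain [OF m settled] by metis
        \<comment> \<open>There are as many chains as bottoms, and the antichain bounds their number
          by the width.\<close>
        have few: "card {v. v < n \<and> s4 ''U'' v = 0} \<le> W"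
          using A(3) index_antichain_le_width [OF P A(1)[unfolded n_def] A(2)] w by simp
        show "runs (bottoms ;; find_embedding W) s4
          (60 * Suc n + 700 * (Suc n * Suc k ^ 3) * Suc (W ^ k)) (\<lambda>s. accepting s \<longleftrightarrow> embeds Q P)"
        proof (rule runs_Seq [OF runs_bottoms])
          show "s4 ''n'' 0 = n" "s4 ''c'' 0 = 0" "s4 ''B'' = (\<lambda>_. 0)"
            using s3 input zero by (simp_all add: s4)
          fix s5
          assume *: "collected (s4 ''U'') n (s5 ''c'' 0) (s5 ''B'') \<and>
            (\<forall>x. x \<notin> {''i'', ''B'', ''c''} \<longrightarrow> s5 x = s4 x)"
          note c = * [THEN conjunct1] and s5 = * [THEN conjunct2, rule_format]
          have cW: "s5 ''c'' 0 \<le> W"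
            using few unfolding c [unfolded collected_def, THEN conjunct2, THEN conjunct1] .
          \<comment> \<open>The parameters are the memory contents reached at run time: the matching
            after the auction and the bottoms collected from it.\<close>
          interpret search_setup n "index_rel P xs" k "index_rel Q ys"
            "s4 ''M''" "s4 ''U''" "s4 ''l''" "s4 ''p''" "s5 ''B''" W
          proof
            show "index_rel Q ys i i" if "i < k" for i
              using that index_poset.le_refl [OF index_poset_index_rel [OF Q]] by (simp add: k_def)
            show "matching (s4 ''M'') (s4 ''U'') (s4 ''l'') (s4 ''p'')"
              by (rule m)
          qed (use chains_complete [OF index_poset_axioms m c cW] in blast)+
          have ready: "ready s5"
            unfolding ready_def
          proof (intro conjI allI impI)
            show "s5 ''k'' 0 = k"
              using s3 [of "''k''"] input by (simp add: s4 s5)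
            show "s5 ''M'' = s4 ''M''"
              by (simp add: s5)
            show "0 < s5 ''P'' (s5 ''R'' u + v) \<longleftrightarrow> index_rel P xs u v"
              if "0 < n \<longrightarrow> u < n \<and> v < n" for u v
              using le [OF that] s4 [of "''P''"] s4 [of "''R''"] by (simp add: s5)
            show "0 < s5 ''Q'' (s5 ''S'' i + j) \<longleftrightarrow> index_rel Q ys i j" if "i < k" "j < k" for i j
              using q [OF that] s4 [of "''Q''"] s4 [of "''S''"] by (simp add: s5)
          qed simp
          have "s5 ''a'' = (\<lambda>_. 0)" "s5 ''d'' 0 = 0" "s5 ''out'' 0 = 0"
            using s3 zero by (simp_all add: s4 s5)
          then show "runs (find_embedding W) s5 (700 * (Suc n * Suc k ^ 3) * Suc (W ^ k))
            (\<lambda>s. accepting s \<longleftrightarrow> embeds Q P)"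
            using runs_find_embedding [of s5] ready search_init [of W] w
              embeds_iff_index_embedding [OF P Q]
            by (simp add: accepting_def n_def k_def)
        qed
      qed (use start le in simp_all)
    qed
  qed
  then show ?thesis
  proof (rule runs_weaken)
    \<comment> \<open>Naming the nonlinear factors leaves linear arithmetic: every summand is
      compared with \<open>b * a\<close>.\<close>
    define a where "a = Suc n ^ 3"
    define b where "b = Suc k ^ 3 * W ^ k"
    have V: "1 \<le> W ^ k"
      using w by (intro one_le_power) simp
    have cube: "m \<le> m ^ 3" for m :: nat
      by (cases m) (simp_all add: power3_eq_cube)
    have na: "Suc n \<le> a"
      unfolding a_def by (rule cube)
    have kb: "Suc k \<le> b"
      unfolding b_def using mult_le_mono [OF cube V, of "Suc k"] by (simp only: mult_1_right)
    have ab: "a \<le> b * a" "b \<le> b * a" "1 \<le> b * a"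
      using na kb by (auto simp: Suc_le_eq)
    have "Suc (W ^ k) \<le> 2 * W ^ k"
      using V by simp
    then have "Suc k ^ 3 * Suc (W ^ k) \<le> 2 * b"
      using mult_le_mono2 [of "Suc (W ^ k)" "2 * W ^ k" "Suc k ^ 3"] unfolding b_def
      by (simp only: mult.left_commute)
    from mult_le_mono [OF na this]
    have main: "700 * (Suc n * Suc k ^ 3) * Suc (W ^ k) \<le> 1400 * (b * a)"
      by (simp only: mult.assoc mult.commute mult.left_commute)
    have "40 * (n + 1) + (40 * (k + 1) + (steps (''i'' ::= Const 0) + (600 * a + (60 * Suc n + t)))) \<le>
      3000 * m" if "t \<le> 1400 * m" "a \<le> m" "b \<le> m" "1 \<le> m" for t m
      using that na kb by simp
    from this [OF main ab]
    show "40 * (n + 1) + (40 * (k + 1) + (steps (''i'' ::= Const 0) + (600 * Suc n ^ 3 +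
      (60 * Suc n + 700 * (Suc n * Suc k ^ 3) * Suc (W ^ k))))) \<le>
      3000 * (Suc k ^ 3 * W ^ k) * Suc n ^ 3"
      unfolding a_def b_def by (simp only: mult.assoc)
  qed
qed

theorem theorem4:
  fixes \<P> :: "'a poset set"
  assumes "\<And>P. P \<in> \<P> \<Longrightarrow> finite_poset P"
    and "bounded_width \<P>"
  shows "\<exists>(alg :: com) (f :: nat \<Rightarrow> real) (g :: nat \<Rightarrow> real) (d :: nat).
    f \<in> O(\<lambda>k. real k * log 2 (real k)) \<and>
    g \<in> O(\<lambda>n. real n ^ d) \<and>
    (\<forall>(Q :: 'b poset) ys P xs.
      finite_poset Q \<and> enumerates ys Q \<and> P \<in> \<P> \<and> enumerates xs P \<longrightarrow>
      (\<exists>t s. exec alg (initial_state Q ys P xs) t s \<and>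
             real t \<le> 2 powr f (card (fst Q)) * g (card (fst P)) \<and>
             (accepting s \<longleftrightarrow> embeds Q P)))"
proof -
  obtain w where w: "\<And>P. P \<in> \<P> \<Longrightarrow> width P \<le> w"
    using assms(2) unfolding bounded_width_def by blast
  \<comment> \<open>The successor makes the width bound strict, hence the base positive.\<close>
  define W where "W = Suc w"
  \<comment> \<open>\<open>2 powr f k\<close> is the factor of the time bound that depends on
    \<open>k\<close>, with the constant 3000 included; \<open>g n\<close> is the rest.
    \<open>W\<close> is fixed for the class, so it counts as a constant.\<close>
  define f where "f k = log 2 3000 + 3 * log 2 (real k + 1) + real k * log 2 (real W)" for k :: nat
  define g where "g n = (real n + 1) ^ 3" for n :: nat
  \<comment> \<open>Only eventual domination counts: \<open>k * log 2 k\<close> vanishes for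
    \<open>k = 0\<close> and \<open>k = 1\<close>.\<close>
  have "(\<lambda>k. real k * log 2 (real W)) \<in> O(\<lambda>k. real k * log 2 (real k))"
    by real_asymp
  moreover have "(\<lambda>k. log 2 3000 + 3 * log 2 (real k + 1)) \<in> O(\<lambda>k. real k * log 2 (real k))"
    by real_asymp
  ultimately have f: "f \<in> O(\<lambda>k. real k * log 2 (real k))"
    unfolding f_def by (rule sum_in_bigo(1) [rotated])
  have g: "g \<in> O(\<lambda>n. real n ^ 3)"
    unfolding g_def by real_asymp
  have powr: "2 powr f k = 3000 * ((real k + 1) ^ 3 * real W ^ k)" for k
  proof -
    have "f k = log 2 (3000 * ((real k + 1) ^ 3 * real W ^ k))"
      by (simp add: f_def W_def log_mult log_nat_power)
    moreover have "0 < 3000 * ((real k + 1) ^ 3 * real W ^ k)"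
      by (simp add: W_def)
    ultimately show ?thesis
      by (simp only: powr_log_cancel)
  qed
  show ?thesis
  proof (rule exI [of _ "embedding_program W"], rule exI [of _ f], rule exI [of _ g], rule exI [of _ 3],
      intro conjI allI impI)
    show "f \<in> O(\<lambda>k. real k * log 2 (real k))" "g \<in> O(\<lambda>n. real n ^ 3)"
      by fact+
    fix Q :: "'b poset" and ys P xs
    assume *: "finite_poset Q \<and> enumerates ys Q \<and> P \<in> \<P> \<and> enumerates xs P"
    then have "runs (embedding_program W) (initial_state Q ys P xs)
      (3000 * (Suc (length ys) ^ 3 * W ^ length ys) * Suc (length xs) ^ 3)
      (\<lambda>s. accepting s \<longleftrightarrow> embeds Q P)"
      using runs_embedding_program [of P xs Q ys W] assms(1) w [of P] by (simp add: W_def)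
    then obtain t s where ts: "exec (embedding_program W) (initial_state Q ys P xs) t s"
      "accepting s \<longleftrightarrow> embeds Q P"
      "t \<le> 3000 * (Suc (length ys) ^ 3 * W ^ length ys) * Suc (length xs) ^ 3"
      unfolding runs_def by blast
    have "length ys = card (fst Q)" "length xs = card (fst P)"
      using * distinct_card by (force simp: enumerates_def)+
    moreover have "real t \<le> real (3000 * (Suc (length ys) ^ 3 * W ^ length ys) * Suc (length xs) ^ 3)"
      using ts(3) by (rule of_nat_mono)
    ultimately have "real t \<le> 2 powr f (card (fst Q)) * g (card (fst P))"
      by (simp add: powr g_def add.commute)
    with ts show "\<exists>t s. exec (embedding_program W) (initial_state Q ys P xs) t s \<and>
             real t \<le> 2 powr f (card (fst Q)) * g (card (fst P)) \<and>
             (accepting s \<longleftrightarrow> embeds Q P)"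
      by blast
  qed
qed

end
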